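(* For any $n\ge k$ and any $\epsilon>0$, $Q(\mathrm{2D\text{-}DConnectivity}_{n,k})=\Omega\big((\sqrt{n}\,k)^{1-\epsilon}\big)$.
   Context: Let $G_{n,k}$ be the directed grid with vertices $(i,j)$, $i\in\{0,\dots,n\}$, $j\in\{0,\dots,k\}$, and directed edges $(i,j)\to(i+1,j)$ (for $i<n$) and $(i,j)\to(i,j+1)$ (for $j<k$). An input is a subgraph $G$ of $G_{n,k}$, described by one bit $x_e$ per edge $e$ of $G_{n,k}$ ($x_e=1$ iff $e\in G$). $\mathrm{2D\text{-}DConnectivity}_{n,k}(x)=1$ iff $G$ contains a directed path from $(0,0)$ to $(n,k)$. $Q(g)$ denotes the bounded-error (success probability at least $2/3$) quantum query complexity of $g$ with respect to the bits $x_e$. *)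

theory Defs
  imports Complex_Main "HOL-Library.FuncSet" "HOL-Library.Extended_Real" "Graph_Theory.Pair_Digraph"
begin

section \<open>Bounded-error quantum query complexity\<close>

text \<open>
  Inputs are bit strings indexed by a finite set \<open>I\<close>, i.e. elements of \<open>I \<rightarrow>\<^sub>E UNIV\<close>. The
  dimension of the workspace is existentially quantified below, so the state space is not a type:
  it is the space of functions on an explicit finite set of basis states \<open>|i, b, w\<rangle>\<close>, with a query
  index \<open>i\<close>, an answer bit \<open>b\<close> and a workspace value \<open>w < d\<close>. The index \<open>None\<close> stands for a null
  query. It adds no power, since querying any position with the answer bit in the state
  \<open>(|0\<rangle> + |1\<rangle>) / \<surd>2\<close> also acts as the identity, but it covers the case of no input bits.
\<close>

type_synonym 'i qlabel = "'i option \<times> bool \<times> nat"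
type_synonym 'i qstate = "'i qlabel \<Rightarrow> complex"
type_synonym 'i qop = "'i qlabel \<Rightarrow> 'i qlabel \<Rightarrow> complex"

definition query_basis :: "'i set \<Rightarrow> nat \<Rightarrow> 'i qlabel set" where
  "query_basis I d = insert None (Some ` I) \<times> UNIV \<times> {..<d}"

definition unitary_op :: "'i qlabel set \<Rightarrow> 'i qop \<Rightarrow> bool" where
  "unitary_op B U \<longleftrightarrow>
     (\<forall>a\<in>B. \<forall>b\<in>B. (\<Sum>c\<in>B. cnj (U c a) * U c b) = (if a = b then 1 else 0)) \<and>
     (\<forall>a\<in>B. \<forall>b\<in>B. (\<Sum>c\<in>B. U a c * cnj (U b c)) = (if a = b then 1 else 0))"

definition apply_op :: "'i qlabel set \<Rightarrow> 'i qop \<Rightarrow> 'i qstate \<Rightarrow> 'i qstate" where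
  "apply_op B U \<psi> = (\<lambda>a. \<Sum>c\<in>B. U a c * \<psi> c)"

text \<open>
  The linear map \<open>|i, b, w\<rangle> \<mapsto> |i, b \<oplus> x\<^sub>i, w\<rangle>\<close>. On amplitudes it acts through the inverse of this
  permutation of the basis, which is the permutation itself; inequality on \<open>bool\<close> is exclusive or.
\<close>

definition query_op :: "('i \<Rightarrow> bool) \<Rightarrow> 'i qstate \<Rightarrow> 'i qstate" where
  "query_op x \<psi> = (\<lambda>(i, b, w). case i of None \<Rightarrow> \<psi> (None, b, w)
                                        | Some j \<Rightarrow> \<psi> (Some j, b \<noteq> x j, w))"

definition initial_state :: "'i qstate" where
  "initial_state = (\<lambda>a. if a = (None, False, 0) then 1 else 0)"

primrec run_state ::
  "'i qlabel set \<Rightarrow> (nat \<Rightarrow> 'i qop) \<Rightarrow> ('i \<Rightarrow> bool) \<Rightarrow> nat \<Rightarrow> 'i qstate" where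
  "run_state B U x 0 = apply_op B (U 0) initial_state"
| "run_state B U x (Suc t) = apply_op B (U (Suc t)) (query_op x (run_state B U x t))"

text \<open>
  The final state is measured in the basis \<open>B\<close>; the output is 1 iff the outcome lies in \<open>A\<close>.
\<close>

definition output_prob ::
  "'i qlabel set \<Rightarrow> 'i qlabel set \<Rightarrow> 'i qstate \<Rightarrow> bool \<Rightarrow> real" where
  "output_prob B A \<psi> v = (\<Sum>a\<in>{a \<in> B. (a \<in> A) = v}. (cmod (\<psi> a))\<^sup>2)"

definition computable_with_queries :: "'i set \<Rightarrow> (('i \<Rightarrow> bool) \<Rightarrow> bool) \<Rightarrow> nat \<Rightarrow> bool" where
  "computable_with_queries I g T \<longleftrightarrow>
     (\<exists>d U A. 0 < d \<and> (\<forall>t\<le>T. unitary_op (query_basis I d) (U t)) \<and> A \<subseteq> query_basis I d \<and>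
        (\<forall>x \<in> I \<rightarrow>\<^sub>E UNIV.
           output_prob (query_basis I d) A (run_state (query_basis I d) U x T) (g x) \<ge> 2 / 3))"

definition quantum_query_complexity :: "'i set \<Rightarrow> (('i \<Rightarrow> bool) \<Rightarrow> bool) \<Rightarrow> enat" where
  "quantum_query_complexity I g = (INF T \<in> {T. computable_with_queries I g T}. enat T)"


section \<open>Directed connectivity in the two-dimensional grid\<close>

definition grid_digraph :: "nat \<Rightarrow> nat \<Rightarrow> (nat \<times> nat) pair_pre_digraph" where
  "grid_digraph n k =
     \<lparr> pverts = {0..n} \<times> {0..k},
       parcs = {((i, j), (i + 1, j)) | i j. i < n \<and> j \<le> k} \<union>
               {((i, j), (i, j + 1)) | i j. i \<le> n \<and> j < k} \<rparr>"

definition input_subgraph ::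
  "nat \<Rightarrow> nat \<Rightarrow> ((nat \<times> nat) \<times> (nat \<times> nat) \<Rightarrow> bool) \<Rightarrow> (nat \<times> nat) pair_pre_digraph" where
  "input_subgraph n k x =
     \<lparr> pverts = pverts (grid_digraph n k), parcs = {e \<in> parcs (grid_digraph n k). x e} \<rparr>"

definition dconnectivity_2d ::
  "nat \<Rightarrow> nat \<Rightarrow> ((nat \<times> nat) \<times> (nat \<times> nat) \<Rightarrow> bool) \<Rightarrow> bool" where
  "dconnectivity_2d n k x \<longleftrightarrow>
     (\<exists>p. pre_digraph.apath (with_proj (input_subgraph n k x)) (0, 0) p (n, k))"

end

theory Submission
  imports Defs
begin

text \<open>
  The lower bound is Ambainis's adversary bound for a relation between 0-inputs and 1-inputs in which
  related inputs differ in one bit. The hard function is an OR of \<open>M\<close> copies of an \<open>l\<close>-fold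
  iterated exact threshold "\<open>m\<close> or \<open>m + 1\<close> of \<open>2m\<close> bits are 1": it has about \<open>M (2m)\<^sup>l\<close> bits and
  query complexity at least of order \<open>\<surd>M m\<^sup>l\<close>. A copy can be evaluated by a walk with steps \<open>\<plusminus>1\<close> whose
  height stays \<open>O(m l)\<close>, that is, by a monotone path in a diagonal strip of logarithmic width. So for
  \<open>k \<approx> (2m + 1)\<^sup>l\<close> about \<open>n / l\<close> disjoint strips of height at most \<open>k\<close> fit into the grid, in parallel,
  and the bound is of order \<open>\<surd>(n / l) m\<^sup>l\<close>, which exceeds \<open>(\<surd>n k) powr (1 - \<epsilon>)\<close> once \<open>m\<close> is large.
\<close>

section \<open>The adversary bound\<close>

definition inner_prod :: "'i qlabel set \<Rightarrow> 'i qstate \<Rightarrow> 'i qstate \<Rightarrow> complex" where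
  "inner_prod B \<phi> \<psi> = (\<Sum>a\<in>B. cnj (\<phi> a) * \<psi> a)"

definition query_perm :: "('i \<Rightarrow> bool) \<Rightarrow> 'i qlabel \<Rightarrow> 'i qlabel" where
  "query_perm x = (\<lambda>(i, b, w). (i, (case i of None \<Rightarrow> b | Some j \<Rightarrow> b \<noteq> x j), w))"

text \<open>The basis labels where \<open>query_perm x\<close> and \<open>query_perm y\<close>
  disagree; all other labels cancel when the inner products before and after a query are
  compared.\<close>

definition query_diff :: "'i qlabel set \<Rightarrow> ('i \<Rightarrow> bool) \<Rightarrow> ('i \<Rightarrow> bool) \<Rightarrow> 'i qlabel set" where
  "query_diff B x y = {a \<in> B. \<exists>i. fst a = Some i \<and> x i \<noteq> y i}"

lemma inner_prod_apply_op:
  assumes "finite B" "unitary_op B U"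
  shows "inner_prod B (apply_op B U \<phi>) (apply_op B U \<psi>) = inner_prod B \<phi> \<psi>"
proof -
  have "inner_prod B (apply_op B U \<phi>) (apply_op B U \<psi>)
      = (\<Sum>a\<in>B. \<Sum>c\<in>B. \<Sum>e\<in>B. cnj (\<phi> c) * \<psi> e * (cnj (U a c) * U a e))"
    unfolding inner_prod_def apply_op_def cnj_sum sum_product by (simp add: mult_ac)
  also have "\<dots> = (\<Sum>c\<in>B. \<Sum>a\<in>B. \<Sum>e\<in>B. cnj (\<phi> c) * \<psi> e * (cnj (U a c) * U a e))"
    by (rule sum.swap)
  also have "\<dots> = (\<Sum>c\<in>B. \<Sum>e\<in>B. \<Sum>a\<in>B. cnj (\<phi> c) * \<psi> e * (cnj (U a c) * U a e))"
    by (intro sum.cong refl sum.swap)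
  also have "\<dots> = (\<Sum>c\<in>B. \<Sum>e\<in>B. cnj (\<phi> c) * \<psi> e * (if c = e then 1 else 0))"
    using assms(2) by (intro sum.cong refl) (simp add: unitary_op_def flip: sum_distrib_left)
  also have "\<dots> = inner_prod B \<phi> \<psi>"
    using assms(1) by (simp add: inner_prod_def if_distrib cong: if_cong)
  finally show ?thesis .
qed

lemma inner_prod_self: "inner_prod B \<psi> \<psi> = of_real (\<Sum>a\<in>B. (cmod (\<psi> a))\<^sup>2)"
  unfolding inner_prod_def of_real_sum
  by (intro sum.cong refl) (simp add: complex_norm_square mult.commute flip: of_real_power)

lemma query_op_eq: "query_op x \<psi> = (\<lambda>a. \<psi> (query_perm x a))"
  by (auto simp: query_op_def query_perm_def fun_eq_iff split: option.splits)

lemma query_perm_query_perm [simp]: "query_perm x (query_perm x a) = a"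
  by (auto simp: query_perm_def split: prod.splits option.splits)

lemma query_perm_in_basis [simp]: "query_perm x a \<in> query_basis I d \<longleftrightarrow> a \<in> query_basis I d"
  by (auto simp: query_perm_def query_basis_def split: prod.splits option.splits)

lemma query_perm_in_diff [simp]:
  "query_perm z a \<in> query_diff (query_basis I d) x y \<longleftrightarrow> a \<in> query_diff (query_basis I d) x y"
proof -
  have "fst (query_perm z a) = fst a" by (auto simp: query_perm_def split: prod.splits)
  then show ?thesis by (simp add: query_diff_def)
qed

lemma sum_query_perm:
  assumes "\<And>a. query_perm x a \<in> S \<longleftrightarrow> a \<in> S"
  shows "(\<Sum>a\<in>S. f (query_perm x a)) = sum f S"
  by (rule sum.reindex_bij_witness[where i = "query_perm x" and j = "query_perm x"])
     (use assms in auto)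

lemma mult_le_weighted_squares:
  fixes a b l :: real
  assumes "l > 0"
  shows "a * b \<le> (l * a\<^sup>2 + b\<^sup>2 / l) / 2"
proof -
  have "0 \<le> (l * a - b)\<^sup>2 / l" using assms by simp
  also have "\<dots> = l * a\<^sup>2 + b\<^sup>2 / l - 2 * (a * b)"
    using assms by (simp add: power2_eq_square field_simps)
  finally show ?thesis by simp
qed

text \<open>
  The free weight \<open>l\<close> replaces the Cauchy-Schwarz inequality: choosing it as
  \<open>\<surd>(|Y| / |X|)\<close> at the end balances the contributions of both sides.
\<close>

lemma query_inner_prod_diff:
  fixes I :: "'i set" and d :: nat and \<phi> \<psi> :: "'i qstate" and l :: real
  defines "B \<equiv> query_basis I d"
  assumes "finite I" "l > 0"
  shows "cmod (inner_prod B (query_op x \<phi>) (query_op y \<psi>) - inner_prod B \<phi> \<psi>)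
    \<le> (\<Sum>a\<in>query_diff B x y. l * (cmod (\<phi> a))\<^sup>2 + (cmod (\<psi> a))\<^sup>2 / l)"
proof -
  let ?D = "query_diff B x y"
  have fin: "finite B" using assms by (simp add: query_basis_def)
  have sub: "?D \<subseteq> B" by (auto simp: query_diff_def)
  have same: "query_perm y a = query_perm x a" if "a \<in> B - ?D" for a
    using that by (cases a) (auto simp: query_perm_def query_diff_def split: option.splits)
  have "(\<Sum>a\<in>B - ?D. cnj (\<phi> (query_perm x a)) * \<psi> (query_perm y a))
      = (\<Sum>a\<in>B - ?D. cnj (\<phi> (query_perm x a)) * \<psi> (query_perm x a))"
    by (rule sum.cong[OF refl]) (simp only: same)
  also have "\<dots> = (\<Sum>a\<in>B - ?D. cnj (\<phi> a) * \<psi> a)"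
    by (rule sum_query_perm[where f = "\<lambda>a. cnj (\<phi> a) * \<psi> a"]) (simp add: B_def)
  finally have "inner_prod B (query_op x \<phi>) (query_op y \<psi>) - inner_prod B \<phi> \<psi>
      = (\<Sum>a\<in>?D. cnj (\<phi> (query_perm x a)) * \<psi> (query_perm y a)) - (\<Sum>a\<in>?D. cnj (\<phi> a) * \<psi> a)"
    unfolding inner_prod_def query_op_eq
    by (simp add: sum.subset_diff[OF sub fin])
  also have "cmod \<dots> \<le> (\<Sum>a\<in>?D. cmod (\<phi> (query_perm x a)) * cmod (\<psi> (query_perm y a)))
      + (\<Sum>a\<in>?D. cmod (\<phi> a) * cmod (\<psi> a))"
    by (intro order_trans[OF norm_triangle_ineq4] add_mono order_trans[OF norm_sum])
       (simp_all add: norm_mult)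
  also have "\<dots> \<le> (\<Sum>a\<in>?D. (l * (cmod (\<phi> (query_perm x a)))\<^sup>2 + (cmod (\<psi> (query_perm y a)))\<^sup>2 / l) / 2)
      + (\<Sum>a\<in>?D. (l * (cmod (\<phi> a))\<^sup>2 + (cmod (\<psi> a))\<^sup>2 / l) / 2)"
    by (intro add_mono sum_mono mult_le_weighted_squares[OF assms(3)])
  also have "(\<Sum>a\<in>?D. (l * (cmod (\<phi> (query_perm x a)))\<^sup>2 + (cmod (\<psi> (query_perm y a)))\<^sup>2 / l) / 2)
      = (\<Sum>a\<in>?D. l * (cmod (\<phi> (query_perm x a)))\<^sup>2 / 2) + (\<Sum>a\<in>?D. (cmod (\<psi> (query_perm y a)))\<^sup>2 / l / 2)"
    by (simp add: sum.distrib add_divide_distrib)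
  \<comment> \<open>Both query permutations map \<open>?D\<close> to itself, so reindexing removes
    them and the two halves add up to full weights.\<close>
  also have "(\<Sum>a\<in>?D. l * (cmod (\<phi> (query_perm x a)))\<^sup>2 / 2) = (\<Sum>a\<in>?D. l * (cmod (\<phi> a))\<^sup>2 / 2)"
    by (rule sum_query_perm[where f = "\<lambda>a. l * (cmod (\<phi> a))\<^sup>2 / 2"]) (simp add: B_def)
  also have "(\<Sum>a\<in>?D. (cmod (\<psi> (query_perm y a)))\<^sup>2 / l / 2) = (\<Sum>a\<in>?D. (cmod (\<psi> a))\<^sup>2 / l / 2)"
    by (rule sum_query_perm[where f = "\<lambda>a. (cmod (\<psi> a))\<^sup>2 / l / 2"]) (simp add: B_def)
  finally show ?thesis
    by (simp add: sum.distrib sum_divide_distrib[symmetric] add_divide_distrib)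
qed

lemma query_inner_prod_self:
  fixes I :: "'i set" and d :: nat and \<psi> :: "'i qstate"
  defines "B \<equiv> query_basis I d"
  shows "inner_prod B (query_op x \<psi>) (query_op x \<psi>) = inner_prod B \<psi> \<psi>"
  unfolding inner_prod_def query_op_eq
  by (rule sum_query_perm[where f = "\<lambda>a. cnj (\<psi> a) * \<psi> a"]) (simp add: B_def)

lemma inner_prod_initial:
  assumes "finite I" "0 < d"
  shows "inner_prod (query_basis I d) initial_state initial_state = 1"
proof -
  have "inner_prod (query_basis I d) initial_state initial_state
      = (\<Sum>a\<in>query_basis I d. if a = (None, False, 0) then 1 else 0)"
    by (auto simp: inner_prod_def initial_state_def intro: sum.cong)
  also have "\<dots> = 1" using assms by (subst sum.delta) (auto simp: query_basis_def)
  finally show ?thesis .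
qed

text \<open>Each state has mass at most 1/3 on its wrong outcome, so the two cannot be nearly
  parallel. The weight 3/2 is a rational stand-in for the square root of 2, which would give the
  slightly smaller bound \<open>2 * sqrt 2 / 3\<close>.\<close>

lemma inner_prod_distinguishing:
  assumes "finite B"
    and "inner_prod B \<phi> \<phi> = 1" "inner_prod B \<psi> \<psi> = 1"
    and "output_prob B A \<phi> False \<ge> 2 / 3" "output_prob B A \<psi> True \<ge> 2 / 3"
  shows "cmod (inner_prod B \<phi> \<psi>) \<le> 17 / 18"
proof -
  let ?P = "{a \<in> B. (a \<in> A) = True}" and ?N = "{a \<in> B. (a \<in> A) = False}"
  have split: "sum f B = sum f ?P + sum f ?N" for f :: "'a qlabel \<Rightarrow> real"
    using assms(1) by (subst sum.union_disjoint[symmetric]) (auto intro: sum.cong)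
  have norm: "(\<Sum>a\<in>B. (cmod (\<phi> a))\<^sup>2) = 1" "(\<Sum>a\<in>B. (cmod (\<psi> a))\<^sup>2) = 1"
    using assms(2,3) unfolding inner_prod_self by (simp_all only: of_real_eq_1_iff)
  have "cmod (inner_prod B \<phi> \<psi>) \<le> (\<Sum>a\<in>B. cmod (\<phi> a) * cmod (\<psi> a))"
    unfolding inner_prod_def by (rule order_trans[OF norm_sum]) (simp add: norm_mult)
  also have "\<dots> = (\<Sum>a\<in>?P. cmod (\<phi> a) * cmod (\<psi> a)) + (\<Sum>a\<in>?N. cmod (\<phi> a) * cmod (\<psi> a))"
    by (rule split)
  also have "\<dots> \<le> (\<Sum>a\<in>?P. (3/2 * (cmod (\<phi> a))\<^sup>2 + (cmod (\<psi> a))\<^sup>2 / (3/2)) / 2)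
      + (\<Sum>a\<in>?N. (2/3 * (cmod (\<phi> a))\<^sup>2 + (cmod (\<psi> a))\<^sup>2 / (2/3)) / 2)"
    by (intro add_mono sum_mono mult_le_weighted_squares) auto
  also have "\<dots> = 3/4 * output_prob B A \<phi> True + output_prob B A \<psi> True / 3
      + output_prob B A \<phi> False / 3 + 3/4 * output_prob B A \<psi> False"
    by (simp add: output_prob_def sum.distrib add_divide_distrib
          flip: sum_distrib_left sum_distrib_right sum_divide_distrib)
  also have "\<dots> \<le> 17 / 18"
    using norm[unfolded split] assms(4,5) by (simp add: output_prob_def)
  finally show ?thesis .
qed

section \<open>Counting over a bipartite relation\<close>

lemma sum_relation_fst:
  fixes f :: "'a \<Rightarrow> 'b \<Rightarrow> 'c::comm_monoid_add"
  assumes "finite X" "finite Y" "R \<subseteq> X \<times> Y"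
  shows "(\<Sum>(x, y)\<in>R. f x y) = (\<Sum>x\<in>X. \<Sum>y\<in>{y. (x, y) \<in> R}. f x y)"
proof -
  have fin: "\<forall>x\<in>X. finite {y. (x, y) \<in> R}"
    using assms(3) by (auto intro: finite_subset[OF _ assms(2)])
  have "R = (SIGMA x:X. {y. (x, y) \<in> R})" using assms(3) by auto
  then show ?thesis using sum.Sigma[OF assms(1) fin, of f] by simp
qed

lemma degree_le_card_relation:
  assumes "finite X" "finite Y" "R \<subseteq> X \<times> Y" "\<And>x. x \<in> X \<Longrightarrow> p \<le> card {y. (x, y) \<in> R}"
  shows "card X * p \<le> card R"
proof -
  have "card R = (\<Sum>x\<in>X. card {y. (x, y) \<in> R})"
    using sum_relation_fst[OF assms(1-3), of "\<lambda>_ _. 1::nat"] by simp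
  then show ?thesis using assms(4) sum_mono[of X "\<lambda>_. p"] by simp
qed

text \<open>Double counting: once \<open>x\<close> and the label \<open>a\<close> are fixed,
  \<open>a\<close> lies in \<open>D x y\<close> for at most one related \<open>y\<close>, so the
  unit mass of \<open>f x\<close> is used at most once for each \<open>x\<close>.\<close>

lemma relation_weight_le:
  fixes f :: "'a \<Rightarrow> 'c \<Rightarrow> real"
  assumes "finite X" "finite Y" "R \<subseteq> X \<times> Y" "finite B"
    and sub: "\<And>x y. D x y \<subseteq> B"
    and one: "\<And>x a. x \<in> X \<Longrightarrow> a \<in> B \<Longrightarrow> card {y. (x, y) \<in> R \<and> a \<in> D x y} \<le> 1"
    and f: "\<And>x a. 0 \<le> f x a" "\<And>x. x \<in> X \<Longrightarrow> (\<Sum>a\<in>B. f x a) = 1"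
  shows "(\<Sum>(x, y)\<in>R. \<Sum>a\<in>D x y. f x a) \<le> real (card X)"
proof -
  have "(\<Sum>(x, y)\<in>R. \<Sum>a\<in>D x y. f x a) = (\<Sum>(x, y)\<in>R. \<Sum>a\<in>B. if a \<in> D x y then f x a else 0)"
    using assms(4) sub by (simp add: sum.inter_restrict[symmetric] Int_absorb1 case_prod_unfold)
  also have "\<dots> = (\<Sum>x\<in>X. \<Sum>y\<in>{y. (x, y) \<in> R}. \<Sum>a\<in>B. if a \<in> D x y then f x a else 0)"
    by (rule sum_relation_fst[OF assms(1-3)])
  also have "\<dots> = (\<Sum>x\<in>X. \<Sum>a\<in>B. \<Sum>y\<in>{y. (x, y) \<in> R}. if a \<in> D x y then f x a else 0)"
    by (intro sum.cong refl sum.swap)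
  also have "\<dots> = (\<Sum>x\<in>X. \<Sum>a\<in>B. real (card {y. (x, y) \<in> R \<and> a \<in> D x y}) * f x a)"
  proof (intro sum.cong refl)
    fix x a
    have "finite {y. (x, y) \<in> R}" using assms(3) by (auto intro: finite_subset[OF _ assms(2)])
    then show "(\<Sum>y\<in>{y. (x, y) \<in> R}. if a \<in> D x y then f x a else 0)
      = real (card {y. (x, y) \<in> R \<and> a \<in> D x y}) * f x a"
      by (simp add: sum.If_cases Int_def)
  qed
  also have "\<dots> \<le> (\<Sum>x\<in>X. \<Sum>a\<in>B. 1 * f x a)"
    using one f(1) by (intro sum_mono mult_right_mono) auto
  also have "\<dots> = real (card X)" using f(2) by simp
  finally show ?thesis .
qed

text \<open>A potential argument: the sum of the inner products over \<open>R\<close> starts at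
  \<open>card R\<close>, must end at no more than 17/18 of that in modulus, and moves by at most
  \<open>2 * sqrt (card X * card Y)\<close> per query. Inputs are encoded through
  \<open>\<phi>\<close> so that one bit of \<open>z\<close> may govern many positions of the actual
  input.\<close>

lemma adversary_bound:
  fixes \<phi> :: "'z \<Rightarrow> 'i \<Rightarrow> bool" and R :: "('z \<times> 'z) set"
  assumes "finite I" "computable_with_queries I g T"
    and "finite X" "finite Y" "R \<subseteq> X \<times> Y" "R \<noteq> {}"
    and dom: "\<And>z. z \<in> X \<union> Y \<Longrightarrow> \<phi> z \<in> I \<rightarrow>\<^sub>E UNIV"
    and val: "\<And>x. x \<in> X \<Longrightarrow> \<not> g (\<phi> x)" "\<And>y. y \<in> Y \<Longrightarrow> g (\<phi> y)"
    and deg: "\<And>x. x \<in> X \<Longrightarrow> p \<le> card {y. (x, y) \<in> R}" "\<And>y. y \<in> Y \<Longrightarrow> q \<le> card {x. (x, y) \<in> R}"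
    and one: "\<And>x i. x \<in> X \<Longrightarrow> i \<in> I \<Longrightarrow> card {y. (x, y) \<in> R \<and> \<phi> x i \<noteq> \<phi> y i} \<le> 1"
      "\<And>y i. y \<in> Y \<Longrightarrow> i \<in> I \<Longrightarrow> card {x. (x, y) \<in> R \<and> \<phi> x i \<noteq> \<phi> y i} \<le> 1"
  shows "sqrt (real p * real q) \<le> 36 * real T"
proof -
  obtain d U A where d: "0 < d" and U: "\<And>t. t \<le> T \<Longrightarrow> unitary_op (query_basis I d) (U t)"
    and out: "\<And>x. x \<in> I \<rightarrow>\<^sub>E UNIV \<Longrightarrow>
      output_prob (query_basis I d) A (run_state (query_basis I d) U x T) (g x) \<ge> 2 / 3"
    using assms(2) unfolding computable_with_queries_def by metis
  define B where "B = query_basis I d"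
  define S where "S z t = run_state B U (\<phi> z) t" for z t
  have finB: "finite B" using assms(1) by (simp add: B_def query_basis_def)
  have finR: "finite R" using assms(3-5) finite_subset by blast
  have X0: "X \<noteq> {}" and Y0: "Y \<noteq> {}" using assms(5,6) by auto
  have start: "inner_prod B (S x 0) (S y 0) = 1" for x y
    using U[of 0] inner_prod_apply_op[OF finB] inner_prod_initial[OF assms(1) d]
    by (simp add: S_def B_def)
  have norm1: "inner_prod B (S z t) (S z t) = 1" if "t \<le> T" for z t
    using that
  proof (induction t)
    case 0 then show ?case by (simp add: start)
  next
    case (Suc t)
    then show ?case
      using U[of "Suc t"] inner_prod_apply_op[OF finB, of "U (Suc t)"]
      by (simp add: S_def B_def query_inner_prod_self)
  qed
  have norm1': "(\<Sum>a\<in>B. (cmod (S z t a))\<^sup>2) = 1" if "t \<le> T" for z t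
    using norm1[OF that, of z] unfolding inner_prod_self by (simp only: of_real_eq_1_iff)
  define l where "l = sqrt (real (card Y) / real (card X))"
  have cX: "real (card X) > 0" and cY: "real (card Y) > 0"
    using X0 Y0 assms(3,4) by (simp_all add: card_gt_0_iff)
  have l: "l > 0" using cX cY by (simp add: l_def)
  define W where "W t = (\<Sum>(x, y)\<in>R. inner_prod B (S x t) (S y t))" for t
  define D where "D x y = query_diff B (\<phi> x) (\<phi> y)" for x y
  have Dsub: "D x y \<subseteq> B" for x y by (auto simp: D_def query_diff_def)
  have Dx: "card {y. (x, y) \<in> R \<and> a \<in> D x y} \<le> 1" if "x \<in> X" "a \<in> B" for x a
  proof (cases "fst a")
    case None then show ?thesis by (simp add: D_def query_diff_def)
  next
    case (Some i)
    then have "i \<in> I" "{y. (x, y) \<in> R \<and> a \<in> D x y} = {y. (x, y) \<in> R \<and> \<phi> x i \<noteq> \<phi> y i}"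
      using that(2) by (auto simp: D_def query_diff_def B_def query_basis_def)
    then show ?thesis using one(1)[OF that(1)] by simp
  qed
  have Dy: "card {x. (x, y) \<in> R \<and> a \<in> D x y} \<le> 1" if "y \<in> Y" "a \<in> B" for y a
  proof (cases "fst a")
    case None then show ?thesis by (simp add: D_def query_diff_def)
  next
    case (Some i)
    then have "i \<in> I" "{x. (x, y) \<in> R \<and> a \<in> D x y} = {x. (x, y) \<in> R \<and> \<phi> x i \<noteq> \<phi> y i}"
      using that(2) by (auto simp: D_def query_diff_def B_def query_basis_def)
    then show ?thesis using one(2)[OF that(1)] by simp
  qed
  have step: "cmod (W (Suc t) - W t) \<le> l * real (card X) + real (card Y) / l" if "Suc t \<le> T" for t
  proof -
    let ?f = "\<lambda>z a. (cmod (S z t a))\<^sup>2"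
    have "W (Suc t) = (\<Sum>(x, y)\<in>R. inner_prod B (query_op (\<phi> x) (S x t)) (query_op (\<phi> y) (S y t)))"
      using inner_prod_apply_op[OF finB, of "U (Suc t)"] U[OF that]
      by (simp add: W_def S_def B_def)
    then have "W (Suc t) - W t = (\<Sum>(x, y)\<in>R.
        inner_prod B (query_op (\<phi> x) (S x t)) (query_op (\<phi> y) (S y t)) - inner_prod B (S x t) (S y t))"
      by (simp add: W_def sum_subtractf case_prod_unfold)
    also have "cmod \<dots> \<le> (\<Sum>(x, y)\<in>R. \<Sum>a\<in>D x y. l * ?f x a + ?f y a / l)"
      unfolding case_prod_unfold B_def D_def
      by (intro order_trans[OF norm_sum] sum_mono query_inner_prod_diff[OF assms(1) l])
    also have "\<dots> = l * (\<Sum>(x, y)\<in>R. \<Sum>a\<in>D x y. ?f x a) + (\<Sum>(x, y)\<in>R. \<Sum>a\<in>D x y. ?f y a) / l"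
      by (simp add: case_prod_unfold sum.distrib flip: sum_distrib_left sum_divide_distrib)
    also have "(\<Sum>(x, y)\<in>R. \<Sum>a\<in>D x y. ?f x a) \<le> real (card X)"
      using norm1'[of t] that by (intro relation_weight_le[OF assms(3-5) finB Dsub Dx]) auto
    \<comment> \<open>The counting lemma sums by first components, so the \<open>Y\<close> side goes
      through the converse relation.\<close>
    also have "(\<Sum>(x, y)\<in>R. \<Sum>a\<in>D x y. ?f y a) = (\<Sum>(y, x)\<in>R\<inverse>. \<Sum>a\<in>D x y. ?f y a)"
      by (rule sum.reindex_bij_witness[of _ prod.swap prod.swap]) auto
    also have "\<dots> \<le> real (card Y)"
      using norm1'[of t] that Dy assms(5)
      by (intro relation_weight_le[OF assms(4,3) _ finB]) (auto simp: Dsub)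
    finally show ?thesis using l by (simp add: divide_right_mono)
  qed
  have "cmod (W t - W 0) \<le> real t * (l * real (card X) + real (card Y) / l)" if "t \<le> T" for t
    using that
  proof (induction t)
    case (Suc t)
    have "cmod (W (Suc t) - W 0) \<le> cmod (W (Suc t) - W t) + cmod (W t - W 0)"
      using norm_triangle_ineq[of "W (Suc t) - W t" "W t - W 0"] by simp
    then show ?case using step[OF Suc.prems] Suc by (simp add: algebra_simps add_divide_distrib)
  qed simp
  then have upper: "cmod (W T - W 0) \<le> real T * (l * real (card X) + real (card Y) / l)" by simp
  have "W 0 = of_nat (card R)" by (simp add: W_def start)
  moreover have "cmod (W T) \<le> (\<Sum>(x, y)\<in>R. 17 / 18)"
    unfolding W_def case_prod_unfold
  proof (intro order_trans[OF norm_sum] sum_mono)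
    fix e assume "e \<in> R"
    then have mem: "fst e \<in> X" "snd e \<in> Y" using assms(5) by auto
    show "cmod (inner_prod B (S (fst e) T) (S (snd e) T)) \<le> 17 / 18"
      using out[OF dom, of "fst e"] out[OF dom, of "snd e"] val mem
      by (intro inner_prod_distinguishing[OF finB norm1 norm1, where A = A])
         (auto simp: S_def B_def)
  qed
  ultimately have "real (card R) / 18 \<le> cmod (W T - W 0)"
    using norm_triangle_ineq2[of "W 0" "W T"] by (simp add: norm_minus_commute)
  with upper have "real (card R) \<le> 18 * real T * (l * real (card X) + real (card Y) / l)" by simp
  moreover have "l * real (card X) = sqrt (real (card X) * real (card Y))"
    "real (card Y) / l = sqrt (real (card X) * real (card Y))"
    using cX cY by (simp_all add: l_def real_sqrt_divide real_sqrt_mult field_simps)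
  ultimately have main: "real (card R) \<le> 36 * real T * sqrt (real (card X) * real (card Y))" by simp
  have "real (card X) * real p \<le> real (card R)"
    using degree_le_card_relation[OF assms(3-5) deg(1)] by (metis of_nat_le_iff of_nat_mult)
  moreover have "real (card Y) * real q \<le> real (card R)"
    using degree_le_card_relation[OF assms(4,3), of "R\<inverse>" q] deg(2) assms(5)
    by (auto simp flip: of_nat_mult)
  \<comment> \<open>Multiplying the two edge counts bounds \<open>card R\<close> from below by
    \<open>sqrt (card X * card Y) * sqrt (p * q)\<close>; the first factor cancels against
    \<open>main\<close>.\<close>
  ultimately have "(real (card X) * real p) * (real (card Y) * real q) \<le> real (card R) * real (card R)"
    by (intro mult_mono) auto
  then have "sqrt ((real (card X) * real (card Y)) * (real p * real q)) \<le> real (card R)"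
    by (intro real_le_lsqrt) (simp_all add: power2_eq_square mult_ac)
  with main have "sqrt (real (card X) * real (card Y)) * sqrt (real p * real q)
      \<le> sqrt (real (card X) * real (card Y)) * (36 * real T)"
    by (simp add: real_sqrt_mult mult_ac)
  then show ?thesis using cX cY by simp
qed

section \<open>Iterated exact thresholds as walks\<close>

text \<open>Blocks are cut off at \<open>L\<close>, so that every property of a block depends on its \<open>L\<close> bits only.\<close>

definition block :: "nat \<Rightarrow> nat \<Rightarrow> (nat \<Rightarrow> bool) \<Rightarrow> nat \<Rightarrow> bool" where
  "block L b x = (\<lambda>p. p < L \<and> x (b * L + p))"

definition flip_bit :: "(nat \<Rightarrow> bool) \<Rightarrow> nat \<Rightarrow> nat \<Rightarrow> bool" where
  "flip_bit x i = x(i := \<not> x i)"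

text \<open>Meant under the promise \<open>threshold_valid\<close>, where the count is
  \<open>a\<close> or \<open>Suc a\<close>; for \<open>a = 0\<close> it is the OR of blocks of which
  at most one is true.\<close>

definition threshold_value :: "nat \<Rightarrow> nat \<Rightarrow> nat \<Rightarrow> ((nat \<Rightarrow> bool) \<Rightarrow> bool) \<Rightarrow> (nat \<Rightarrow> bool) \<Rightarrow> bool" where
  "threshold_value N a L f x \<longleftrightarrow> card {b \<in> {..<N}. f (block L b x)} = Suc a"

definition threshold_valid ::
  "nat \<Rightarrow> nat \<Rightarrow> nat \<Rightarrow> ((nat \<Rightarrow> bool) \<Rightarrow> bool) \<Rightarrow> ((nat \<Rightarrow> bool) \<Rightarrow> bool) \<Rightarrow> (nat \<Rightarrow> bool) \<Rightarrow> bool" where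
  "threshold_valid N a L V f x \<longleftrightarrow>
     (\<forall>b<N. V (block L b x)) \<and> card {b \<in> {..<N}. f (block L b x)} \<in> {a, Suc a}"

text \<open>Only flips that keep the promise \<open>V\<close> count. The numbers \<open>p\<close>
  and \<open>q\<close> become the two degrees of the adversary relation formed by single-bit
  flips.\<close>

definition sensitive ::
  "nat \<Rightarrow> ((nat \<Rightarrow> bool) \<Rightarrow> bool) \<Rightarrow> ((nat \<Rightarrow> bool) \<Rightarrow> bool) \<Rightarrow> nat \<Rightarrow> nat \<Rightarrow> bool" where
  "sensitive L V f p q \<longleftrightarrow>
     (\<forall>x. V x \<longrightarrow> \<not> f x \<longrightarrow> p \<le> card {i \<in> {..<L}. V (flip_bit x i) \<and> f (flip_bit x i)}) \<and>
     (\<forall>x. V x \<longrightarrow> f x \<longrightarrow> q \<le> card {i \<in> {..<L}. V (flip_bit x i) \<and> \<not> f (flip_bit x i)})"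

lemma flip_bit_flip_bit [simp]: "flip_bit (flip_bit x i) i = x"
  by (auto simp: flip_bit_def)

lemma flip_bit_inject [simp]: "flip_bit x i = flip_bit x j \<longleftrightarrow> i = j"
  by (auto simp: flip_bit_def fun_eq_iff)

lemma mult_add_eq_iff:
  fixes p q L :: nat
  assumes "p < L" "q < L"
  shows "b * L + p = c * L + q \<longleftrightarrow> b = c \<and> p = q"
proof
  assume h: "b * L + p = c * L + q"
  have "(b * L + p) div L = b" "(c * L + q) div L = c" using assms by auto
  with h show "b = c \<and> p = q" by auto
qed auto

lemma block_flip_bit:
  assumes "i < L"
  shows "block L b (flip_bit x (c * L + i)) = (if b = c then flip_bit (block L b x) i else block L b x)"
  using assms by (auto simp: block_def flip_bit_def fun_eq_iff mult_add_eq_iff)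

text \<open>Different pairs of block and offset give different positions, so lower bounds inside the
  blocks add up.\<close>

lemma card_block_positions:
  fixes P :: "nat \<Rightarrow> nat \<Rightarrow> bool"
  assumes "S \<subseteq> {..<N}" "\<And>b. b \<in> S \<Longrightarrow> p \<le> card {i \<in> {..<L}. P b i}"
    and "\<And>b i. b \<in> S \<Longrightarrow> i < L \<Longrightarrow> P b i \<Longrightarrow> Q (b * L + i)"
  shows "card S * p \<le> card {i \<in> {..<N * L}. Q i}"
proof -
  have fin: "finite S" using assms(1) finite_subset by blast
  let ?A = "SIGMA b:S. {i \<in> {..<L}. P b i}"
  have "card S * p \<le> (\<Sum>b\<in>S. card {i \<in> {..<L}. P b i})"
    using assms(2) sum_mono[of S "\<lambda>_. p"] by simp
  also have "\<dots> = card ?A" using fin by simp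
  also have "\<dots> = card ((\<lambda>(b, i). b * L + i) ` ?A)"
    by (rule card_image[symmetric]) (auto simp: inj_on_def mult_add_eq_iff)
  also have "\<dots> \<le> card {i \<in> {..<N * L}. Q i}"
  proof (intro card_mono subsetI)
    fix j assume "j \<in> (\<lambda>(b, i). b * L + i) ` ?A"
    then obtain b i where j: "j = b * L + i" "b \<in> S" "i < L" "P b i" by auto
    have "j < Suc b * L" using j by simp
    also have "\<dots> \<le> N * L" using j(2) assms(1) by (intro mult_le_mono1) auto
    finally show "j \<in> {i \<in> {..<N * L}. Q i}" using assms(3) j by auto
  qed simp
  finally show ?thesis .
qed

text \<open>At count \<open>a\<close>, turning any of the \<open>N - a\<close> false blocks true
  changes the value; at count \<open>Suc a\<close>, turning any of the true blocks false does. A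
  flip touches a single block, so the sensitivities multiply.\<close>

lemma sensitive_threshold:
  assumes "sensitive L V f p q"
  shows "sensitive (N * L) (threshold_valid N a L V f) (threshold_value N a L f) ((N - a) * p) (Suc a * q)"
  unfolding sensitive_def
proof (intro conjI allI impI)
  fix x assume x: "threshold_valid N a L V f x" "\<not> threshold_value N a L f x"
  let ?F = "{b \<in> {..<N}. f (block L b x)}" and ?S = "{b \<in> {..<N}. \<not> f (block L b x)}"
  have cF: "card ?F = a" and V: "\<And>b. b < N \<Longrightarrow> V (block L b x)"
    using x by (simp_all add: threshold_valid_def threshold_value_def)
  have "?S = {..<N} - ?F" by auto
  then have "card ?S = N - a" using cF by (simp only:) (subst card_Diff_subset, auto)
  moreover have "card ?S * p \<le> card {i \<in> {..<N * L}. threshold_valid N a L V f (flip_bit x i)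
      \<and> threshold_value N a L f (flip_bit x i)}"
  proof (rule card_block_positions[where P = "\<lambda>b i. V (flip_bit (block L b x) i) \<and> f (flip_bit (block L b x) i)"])
    fix b i assume b: "b \<in> ?S" "i < L" "V (flip_bit (block L b x) i) \<and> f (flip_bit (block L b x) i)"
    have "{c \<in> {..<N}. f (block L c (flip_bit x (b * L + i)))} = insert b ?F"
      using b by (auto simp: block_flip_bit)
    moreover have "b \<notin> ?F" using b by simp
    ultimately show "threshold_valid N a L V f (flip_bit x (b * L + i))
        \<and> threshold_value N a L f (flip_bit x (b * L + i))"
      using b V cF by (simp add: threshold_valid_def threshold_value_def block_flip_bit)
  next
    fix b assume "b \<in> ?S"
    then show "p \<le> card {i \<in> {..<L}. V (flip_bit (block L b x) i) \<and> f (flip_bit (block L b x) i)}"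
      using assms V[of b] unfolding sensitive_def by simp
  qed auto
  ultimately show "(N - a) * p \<le> card {i \<in> {..<N * L}. threshold_valid N a L V f (flip_bit x i)
      \<and> threshold_value N a L f (flip_bit x i)}" by simp
next
  fix x assume x: "threshold_valid N a L V f x" "threshold_value N a L f x"
  let ?F = "{b \<in> {..<N}. f (block L b x)}"
  have cF: "card ?F = Suc a" and V: "\<And>b. b < N \<Longrightarrow> V (block L b x)"
    using x by (simp_all add: threshold_valid_def threshold_value_def)
  have "card ?F * q \<le> card {i \<in> {..<N * L}. threshold_valid N a L V f (flip_bit x i)
      \<and> \<not> threshold_value N a L f (flip_bit x i)}"
  proof (rule card_block_positions[where P = "\<lambda>b i. V (flip_bit (block L b x) i) \<and> \<not> f (flip_bit (block L b x) i)"])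
    fix b i assume b: "b \<in> ?F" "i < L" "V (flip_bit (block L b x) i) \<and> \<not> f (flip_bit (block L b x) i)"
    have "{c \<in> {..<N}. f (block L c (flip_bit x (b * L + i)))} = ?F - {b}"
      using b by (auto simp: block_flip_bit)
    then show "threshold_valid N a L V f (flip_bit x (b * L + i))
        \<and> \<not> threshold_value N a L f (flip_bit x (b * L + i))"
      using b V cF by (simp add: threshold_valid_def threshold_value_def block_flip_bit)
  next
    fix b assume "b \<in> ?F"
    then show "q \<le> card {i \<in> {..<L}. V (flip_bit (block L b x) i) \<and> \<not> f (flip_bit (block L b x) i)}"
      using assms V[of b] unfolding sensitive_def by simp
  qed auto
  then show "Suc a * q \<le> card {i \<in> {..<N * L}. threshold_valid N a L V f (flip_bit x i)
      \<and> \<not> threshold_value N a L f (flip_bit x i)}" using cF by simp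
qed

text \<open>Filling the first \<open>a\<close> or \<open>Suc a\<close> blocks with a true instance
  and the rest with a false one meets the promise. This makes the adversary relation
  nonempty.\<close>

lemma threshold_realizable:
  assumes "a < N" "0 < L" "\<And>v. \<exists>x. V x \<and> f x = v \<and> (\<forall>p\<ge>L. \<not> x p)"
  shows "\<exists>x. threshold_valid N a L V f x \<and> threshold_value N a L f x = v \<and> (\<forall>p\<ge>N * L. \<not> x p)"
proof -
  have "\<forall>v. \<exists>x. V x \<and> f x = v \<and> (\<forall>p\<ge>L. \<not> x p)" using assms(3) by blast
  from choice[OF this] obtain u where u: "\<And>v. V (u v)" "\<And>v. f (u v) = v" "\<And>v p. p \<ge> L \<Longrightarrow> \<not> u v p"
    by blast
  define c where "c = (if v then Suc a else a)"
  define x where "x p \<longleftrightarrow> p < N * L \<and> u (p div L < c) (p mod L)" for p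
  have blk: "block L b x = u (b < c)" if "b < N" for b
  proof
    fix p
    have "b * L + p < N * L" if "p < L"
    proof -
      have "b * L + p < Suc b * L" using that by simp
      also have "\<dots> \<le> N * L" using \<open>b < N\<close> by (intro mult_le_mono1) auto
      finally show ?thesis .
    qed
    then show "block L b x p = u (b < c) p" using u(3)[of p] by (cases "p < L") (auto simp: block_def x_def)
  qed
  have "c \<le> N" using assms(1) by (simp add: c_def)
  moreover have "f (block L b x) \<longleftrightarrow> b < c" if "b < N" for b
    using blk[OF that] u(2) by simp
  ultimately have "{b \<in> {..<N}. f (block L b x)} = {..<c}" by auto
  then have "card {b \<in> {..<N}. f (block L b x)} = c" by simp
  moreover have "V (block L b x)" if "b < N" for b
    using blk[OF that] u(1) by simp
  moreover have "\<forall>p\<ge>N * L. \<not> x p" by (simp add: x_def)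
  ultimately show ?thesis
    unfolding threshold_valid_def threshold_value_def by (intro exI[of _ x]) (simp add: c_def)
qed

text \<open>
  Level \<open>l + 1\<close> is the exact threshold \<open>m\<close> versus \<open>m + 1\<close> of \<open>2m\<close> blocks of level \<open>l\<close>. Read as a walk
  (1 is a step up, 0 a step down), a block of level \<open>l\<close> has displacement \<open>\<plusminus>1\<close>, so the \<open>2m\<close> blocks
  together have displacement 0 or 2; the forced last bit 0 turns this into \<open>\<plusminus>1\<close> again.
\<close>

primrec iter_length :: "nat \<Rightarrow> nat \<Rightarrow> nat" where
  "iter_length m 0 = 1"
| "iter_length m (Suc l) = Suc (2 * m * iter_length m l)"

primrec iter_value :: "nat \<Rightarrow> nat \<Rightarrow> (nat \<Rightarrow> bool) \<Rightarrow> bool" where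
  "iter_value m 0 = (\<lambda>x. x 0)"
| "iter_value m (Suc l) = threshold_value (2 * m) m (iter_length m l) (iter_value m l)"

primrec iter_valid :: "nat \<Rightarrow> nat \<Rightarrow> (nat \<Rightarrow> bool) \<Rightarrow> bool" where
  "iter_valid m 0 = (\<lambda>x. True)"
| "iter_valid m (Suc l) = (\<lambda>x. threshold_valid (2 * m) m (iter_length m l) (iter_valid m l) (iter_value m l) x
     \<and> \<not> x (2 * m * iter_length m l))"

lemma iter_length_pos: "0 < iter_length m l"
  by (cases l) auto

lemma iter_length_le: "iter_length m l \<le> (2 * m + 1) ^ l"
proof (induction l)
  case (Suc l)
  have "iter_length m (Suc l) \<le> (2 * m + 1) * iter_length m l"
    using iter_length_pos[of m l] by simp
  also have "\<dots> \<le> (2 * m + 1) * (2 * m + 1) ^ l" by (intro mult_left_mono Suc) simp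
  finally show ?case by simp
qed simp

lemma odd_iter_length: "odd (iter_length m l)"
  by (cases l) auto

lemma iter_sensitive: "sensitive (iter_length m l) (iter_valid m l) (iter_value m l) (m ^ l) (Suc m ^ l)"
proof (induction l)
  case 0
  have "{i \<in> {..<Suc 0}. P i} = (if P 0 then {0} else {})" for P :: "nat \<Rightarrow> bool" by auto
  then show ?case by (simp add: sensitive_def flip_bit_def)
next
  case (Suc l)
  let ?L = "iter_length m l"
  let ?V = "threshold_valid (2 * m) m ?L (iter_valid m l) (iter_value m l)"
  let ?f = "threshold_value (2 * m) m ?L (iter_value m l)"
  have sens: "sensitive (2 * m * ?L) ?V ?f (m ^ Suc l) (Suc m ^ Suc l)"
    using sensitive_threshold[OF Suc, of "2 * m" m] by simp
  \<comment> \<open>Flips at positions below \<open>2 * m * ?L\<close> leave the forced last bit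
    alone, so they stay valid one level up.\<close>
  have le: "card {i \<in> {..<2 * m * ?L}. ?V (flip_bit x i) \<and> P (flip_bit x i)}
      \<le> card {i \<in> {..<iter_length m (Suc l)}. iter_valid m (Suc l) (flip_bit x i) \<and> P (flip_bit x i)}"
    if "iter_valid m (Suc l) x" for x P
    using that by (intro card_mono) (auto simp: flip_bit_def)
  have valid: "?V x" if "iter_valid m (Suc l) x" for x
    using that by simp
  show ?case
    unfolding sensitive_def
  proof (intro conjI allI impI)
    fix x assume x: "iter_valid m (Suc l) x" "\<not> iter_value m (Suc l) x"
    then have "m ^ Suc l \<le> card {i \<in> {..<2 * m * ?L}. ?V (flip_bit x i) \<and> ?f (flip_bit x i)}"
      using sens valid[of x] unfolding sensitive_def by simp
    from this le[OF x(1)] show "m ^ Suc l \<le> card {i \<in> {..<iter_length m (Suc l)}.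
        iter_valid m (Suc l) (flip_bit x i) \<and> iter_value m (Suc l) (flip_bit x i)}"
      unfolding iter_value.simps by (rule order_trans)
  next
    fix x assume x: "iter_valid m (Suc l) x" "iter_value m (Suc l) x"
    then have "Suc m ^ Suc l \<le> card {i \<in> {..<2 * m * ?L}. ?V (flip_bit x i) \<and> \<not> ?f (flip_bit x i)}"
      using sens valid[of x] unfolding sensitive_def by simp
    from this le[OF x(1)] show "Suc m ^ Suc l \<le> card {i \<in> {..<iter_length m (Suc l)}.
        iter_valid m (Suc l) (flip_bit x i) \<and> \<not> iter_value m (Suc l) (flip_bit x i)}"
      unfolding iter_value.simps by (rule order_trans)
  qed
qed

lemma iter_realizable:
  assumes "0 < m"
  shows "\<exists>x. iter_valid m l x \<and> iter_value m l x = v \<and> (\<forall>p\<ge>iter_length m l. \<not> x p)"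
proof (induction l arbitrary: v)
  case 0
  show ?case by (intro exI[of _ "\<lambda>p. v \<and> p = 0"]) auto
next
  case (Suc l)
  obtain x where "threshold_valid (2 * m) m (iter_length m l) (iter_valid m l) (iter_value m l) x"
    "threshold_value (2 * m) m (iter_length m l) (iter_value m l) x = v"
    "\<forall>p\<ge>2 * m * iter_length m l. \<not> x p"
    using threshold_realizable[of m "2 * m" "iter_length m l" "iter_valid m l" "iter_value m l" v,
        OF _ iter_length_pos Suc] assms by auto
  then show ?case by (intro exI[of _ x]) simp
qed

section \<open>Heights of the walks\<close>

definition height :: "(nat \<Rightarrow> bool) \<Rightarrow> nat \<Rightarrow> int" where
  "height x t = (\<Sum>p<t. if x p then 1 else - 1)"

lemma height_0 [simp]: "height x 0 = 0"
  and height_Suc [simp]: "height x (Suc t) = height x t + (if x t then 1 else - 1)"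
  by (simp_all add: height_def)

lemma height_add_block:
  assumes "r \<le> L"
  shows "height x (b * L + r) = height x (b * L) + height (block L b x) r"
  using assms by (induction r) (auto simp: block_def)

lemma height_blocks: "height x (b * L) = (\<Sum>c<b. height (block L c x) L)"
proof (induction b)
  case (Suc b)
  then show ?case using height_add_block[of L L x b] by (simp add: add.commute)
qed simp

text \<open>Among \<open>2 * m\<close> blocks, \<open>m\<close> or \<open>m + 1\<close> true ones
  give displacement 0 or 2 before the forced step down. For the band, each complete block moves the
  walk by one, so these contribute at most \<open>2 * m\<close>, and the unfinished block is bounded
  by induction. Hence the band grows only linearly with the level.\<close>

lemma height_iter:
  assumes "iter_valid m l x"
  shows "height x (iter_length m l) = (if iter_value m l x then 1 else - 1)"
    and "t \<le> iter_length m l \<Longrightarrow> \<bar>height x t\<bar> \<le> 1 + (2 * int m + 1) * int l"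
  using assms
proof (induction l arbitrary: x t)
  case 0
  { case 1 then show ?case by simp }
  { case 2 then show ?case by (cases t) auto }
next
  case (Suc l)
  let ?L = "iter_length m l" and ?S = "\<lambda>x. {b \<in> {..<2 * m}. iter_value m l (block (iter_length m l) b x)}"
  have blk: "height (block ?L c x) ?L = (if c \<in> ?S x then 1 else - 1)"
    if "iter_valid m (Suc l) x" "c < 2 * m" for c x
    using Suc.IH(1)[of "block ?L c x"] that by (simp add: threshold_valid_def)
  have full: "height x (2 * m * ?L) = (if iter_value m (Suc l) x then 2 else 0)"
    if "iter_valid m (Suc l) x" for x
  proof -
    have "height x (2 * m * ?L) = (\<Sum>c<2 * m. 2 * (if c \<in> ?S x then 1 else 0) - 1)"
      using blk[OF that] unfolding height_blocks by (intro sum.cong) auto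
    also have "\<dots> = 2 * (\<Sum>c<2 * m. if c \<in> ?S x then 1 else 0) - 2 * int m"
      by (simp add: sum_subtractf sum_distrib_left)
    also have "(\<Sum>c<2 * m. if c \<in> ?S x then 1 else (0::int)) = int (card (?S x))"
      by (simp add: sum.If_cases Int_def)
    finally show ?thesis using that by (auto simp: threshold_valid_def threshold_value_def)
  qed
  { case 1
    then show ?case using full[OF 1] by simp }
  { case 2
    show ?case
    proof (cases "t = iter_length m (Suc l)")
      case True
      then show ?thesis using full[OF 2(2)] 2(2) by auto
    next
      case False
      define b r where "b = t div ?L" and "r = t mod ?L"
      have t: "t = b * ?L + r" "r < ?L"
        using iter_length_pos[of m l] by (simp_all only: b_def r_def div_mult_mod_eq mod_less_divisor)
      have tle: "t \<le> 2 * m * ?L" using 2(1) False by simp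
      then have b: "b \<le> 2 * m"
        using div_le_mono[OF tle, of ?L] iter_length_pos[of m l] by (simp add: b_def)
      have "\<bar>height x (b * ?L)\<bar> \<le> (\<Sum>c<b. \<bar>height (block ?L c x) ?L\<bar>)"
        unfolding height_blocks by (rule sum_abs)
      also have "\<dots> \<le> (\<Sum>c<b. 1)" using b blk[OF 2(2)] by (intro sum_mono) auto
      also have "\<dots> \<le> 2 * int m" using b by simp
      finally have 1: "\<bar>height x (b * ?L)\<bar> \<le> 2 * int m" .
      have "\<bar>height (block ?L b x) r\<bar> \<le> 1 + (2 * int m + 1) * int l"
      proof (cases "b < 2 * m")
        case True
        then show ?thesis using Suc.IH(2)[of r "block ?L b x"] t(2) 2(2) by (simp add: threshold_valid_def)
      next
        case False
        then have "b = 2 * m" using b by simp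
        then have "r = 0" using tle t(1) by simp
        then show ?thesis by simp
      qed
      with 1 show ?thesis
        using height_add_block[of r ?L x b] t by (simp add: algebra_simps)
    qed }
qed

section \<open>Diagonal strips in the grid\<close>

lemma finite_grid_arcs: "finite (parcs (grid_digraph n k))"
  by (rule finite_subset[of _ "({0..n} \<times> {0..k}) \<times> ({0..n} \<times> {0..k})"])
     (auto simp: grid_digraph_def)

text \<open>Every walk can be shortened to a simple path, so connectivity becomes a reflexive
  transitive closure, open to rule induction.\<close>

lemma dconnectivity_2d_iff:
  "dconnectivity_2d n k x \<longleftrightarrow> ((0, 0), (n, k)) \<in> (parcs (input_subgraph n k x))\<^sup>*"
proof -
  interpret pair_wf_digraph "input_subgraph n k x"
    by unfold_locales (auto simp: input_subgraph_def grid_digraph_def)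
  have "(0, 0) \<in> pverts (input_subgraph n k x)"
    by (simp add: input_subgraph_def grid_digraph_def)
  then show ?thesis
    using reachable_conv'[of "(0, 0)" "(n, k)"] reachable_apath[of "(0, 0)" "(n, k)"]
    by (simp add: dconnectivity_2d_def)
qed

section \<open>Up steps of a walk, and reachability along rows and columns\<close>

definition ups :: "(nat \<Rightarrow> bool) \<Rightarrow> nat \<Rightarrow> nat" where
  "ups x t = card {p \<in> {..<t}. x p}"

lemma ups_0 [simp]: "ups x 0 = 0"
  by (simp add: ups_def)

lemma ups_Suc [simp]: "ups x (Suc t) = (if x t then Suc (ups x t) else ups x t)"
proof -
  have "{p \<in> {..<Suc t}. x p} = (if x t then insert t {p \<in> {..<t}. x p} else {p \<in> {..<t}. x p})"
    by (auto simp: less_Suc_eq)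
  then show ?thesis by (simp add: ups_def)
qed

lemma height_eq_ups: "height x t = 2 * int (ups x t) - int t"
  by (induction t) auto

lemma ups_mono: "s \<le> t \<Longrightarrow> ups x s \<le> ups x t"
  unfolding ups_def by (rule card_mono) auto

lemma ups_le: "ups x t \<le> t"
  by (induction t) auto

lemma right_reachable:
  assumes "\<And>i. a \<le> i \<Longrightarrow> i < b \<Longrightarrow> ((i, j), (Suc i, j)) \<in> E" "a \<le> b"
  shows "((a, j), (b, j)) \<in> E\<^sup>*"
  using assms(2,1) by (induction b rule: dec_induct) (auto intro: rtrancl_into_rtrancl)

lemma up_reachable:
  assumes "\<And>j. a \<le> j \<Longrightarrow> j < b \<Longrightarrow> ((i, j), (i, Suc j)) \<in> E" "a \<le> b"
  shows "((i, a), (i, b)) \<in> E\<^sup>*"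
  using assms(2,1) by (induction b rule: dec_induct) (auto intro: rtrancl_into_rtrancl)

text \<open>
  \<open>M\<close> walks of length \<open>L = 2h - 1\<close>, confined to \<open>|height| \<le> W\<close>, are drawn in the grid as monotone
  paths (1 is a step \<open>(0, 1)\<close>, 0 is a step \<open>(1, 0)\<close>) in disjoint diagonal strips: strip \<open>s\<close> consists
  of the vertices \<open>(i, j)\<close> whose difference \<open>i - j\<close> lies between \<open>s (2W + 1)\<close> and \<open>s (2W + 1) + 2W\<close>,
  and its walk starts at \<open>(strip_start s, 0)\<close>. All arcs of a strip on one antidiagonal are governed
  by the same bit. The bottom row leads to all strips; row \<open>h\<close> and then column \<open>n\<close> lead to the sink,
  and row \<open>h\<close> is reached exactly when some walk ends with \<open>h\<close> up steps.
\<close>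

locale strip_grid =
  fixes n k M L W h :: nat
  assumes length_eq: "L + 1 = 2 * h" and h_le: "h \<le> k" and fits: "M * (2 * W + 1) + L \<le> n"
begin

definition strip :: "nat \<times> nat \<Rightarrow> nat" where
  "strip v = (fst v - snd v) div (2 * W + 1)"

text \<open>A walk at height \<open>y\<close> lies on the diagonal
  \<open>i - j = strip_start s - y\<close>, so starting in the middle of the strip leaves room
  \<open>W\<close> on both sides.\<close>

definition strip_start :: "nat \<Rightarrow> nat" where
  "strip_start s = s * (2 * W + 1) + W"

text \<open>Every arc raises the coordinate sum by one, so this counts the steps since the start of
  the walk.\<close>

definition strip_time :: "nat \<times> nat \<Rightarrow> nat" where
  "strip_time v = fst v + snd v - strip_start (strip v)"

text \<open>The comparisons of coordinates and with \<open>strip_start\<close> keep the truncated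
  subtractions in \<open>strip\<close> and \<open>strip_time\<close> exact. Equal strips at both
  ends forbid crossing from one walk to another.\<close>

definition strip_arc :: "(nat \<times> nat) \<times> (nat \<times> nat) \<Rightarrow> bool" where
  "strip_arc = (\<lambda>(u, v). snd u < h \<and> snd u \<le> fst u \<and> snd v \<le> fst v \<and> strip u = strip v \<and> strip u < M
     \<and> strip_start (strip u) \<le> fst u + snd u \<and> strip_time u < L)"

definition free_arc :: "(nat \<times> nat) \<times> (nat \<times> nat) \<Rightarrow> bool" where
  "free_arc = (\<lambda>(u, v). if snd u = snd v then snd u = 0 \<or> snd u = h else fst u = n \<and> h \<le> snd u)"

definition arc_bit :: "(nat \<times> nat) \<times> (nat \<times> nat) \<Rightarrow> nat" where
  "arc_bit = (\<lambda>(u, v). strip u * L + strip_time u)"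

text \<open>The last comparison tells whether the arc goes up, so at each vertex only the direction
  prescribed by the bit is present. Arcs that are neither free nor in a strip are absent.\<close>

definition grid_input :: "(nat \<Rightarrow> bool) \<Rightarrow> (nat \<times> nat) \<times> (nat \<times> nat) \<Rightarrow> bool" where
  "grid_input z = restrict
     (\<lambda>e. free_arc e \<or> strip_arc e \<and> (z (arc_bit e) \<longleftrightarrow> snd (fst e) < snd (snd e)))
     (parcs (grid_digraph n k))"

abbreviation open_arcs :: "(nat \<Rightarrow> bool) \<Rightarrow> ((nat \<times> nat) \<times> (nat \<times> nat)) set" where
  "open_arcs z \<equiv> parcs (input_subgraph n k (grid_input z))"

text \<open>Each arc depends on at most one bit. For inputs related by a flip this gives the
  uniqueness condition of the adversary bound.\<close>

lemma grid_input_neq: "grid_input z e \<noteq> grid_input z' e \<Longrightarrow> z (arc_bit e) \<noteq> z' (arc_bit e)"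
  by (auto simp: grid_input_def restrict_def split: if_splits)

lemma right_open_iff:
  "((i, j), (Suc i, j)) \<in> open_arcs z \<longleftrightarrow> i < n \<and> j \<le> k \<and>
     (j = 0 \<or> j = h \<or> strip_arc ((i, j), (Suc i, j)) \<and> \<not> z (arc_bit ((i, j), (Suc i, j))))"
  by (auto simp: input_subgraph_def grid_digraph_def grid_input_def free_arc_def)

lemma up_open_iff:
  "((i, j), (i, Suc j)) \<in> open_arcs z \<longleftrightarrow> i \<le> n \<and> j < k \<and>
     (i = n \<and> h \<le> j \<or> strip_arc ((i, j), (i, Suc j)) \<and> z (arc_bit ((i, j), (i, Suc j))))"
  by (auto simp: input_subgraph_def grid_digraph_def grid_input_def free_arc_def)

lemma open_arcs_cases:
  assumes "(u, v) \<in> open_arcs z"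
  obtains i j where "u = (i, j)" "v = (Suc i, j)" | i j where "u = (i, j)" "v = (i, Suc j)"
  using assms by (auto simp: input_subgraph_def grid_digraph_def)

text \<open>The invariant \<open>inv\<close> keeps every reachable vertex below row
  \<open>h\<close>: off the bottom row, the row is at most the number of up steps made by the walk
  of that strip so far. Displacement -1 allows only \<open>h - 1\<close> up steps, and the sink lies
  in row \<open>k \<ge> h\<close>.\<close>

lemma not_connected:
  assumes down: "\<And>s. s < M \<Longrightarrow> height (block L s z) L = - 1"
  shows "\<not> dconnectivity_2d n k (grid_input z)"
proof -
  have top: "ups (block L s z) t < h" if "s < M" "t \<le> L" for s t
    using ups_mono[OF that(2), of "block L s z"] down[OF that(1)] length_eq
    by (simp add: height_eq_ups)
  have h0: "0 < h" using length_eq by simp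
  have bit: "z (arc_bit (u, v)) = block L (strip u) z (strip_time u)" if "strip_time u < L" for u v
    using that by (simp add: arc_bit_def block_def)
  \<comment> \<open>Entering a strip late along the bottom row only loses height against the walk from its start.\<close>
  define inv where "inv v \<longleftrightarrow> snd v < h \<and> (0 < snd v \<longrightarrow> strip v < M
      \<and> strip_start (strip v) \<le> fst v + snd v \<and> strip_time v \<le> L
      \<and> snd v \<le> ups (block L (strip v) z) (strip_time v))" for v :: "nat \<times> nat"
  have inv_step: "inv v" if "inv u" "(u, v) \<in> open_arcs z" for u v
    using that(2)
  proof (cases rule: open_arcs_cases)
    case (1 i j)
    show ?thesis
    proof (cases "j = 0")
      case True
      then show ?thesis using 1 h0 by (simp add: inv_def)
    next
      case False
      have s: "strip_arc (u, v)" "\<not> z (arc_bit (u, v))"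
        using that(2) \<open>inv u\<close> False 1 by (auto simp: right_open_iff inv_def)
      then have "strip v = strip u" "strip_start (strip u) \<le> fst u + snd u"
        by (auto simp: strip_arc_def)
      then have "strip_time v = Suc (strip_time u)"
        using 1 by (simp add: strip_time_def Suc_diff_le)
      then show ?thesis
        using s bit[of u v] \<open>inv u\<close> 1 False by (auto simp: inv_def strip_arc_def)
    qed
  next
    case (2 i j)
    have s: "strip_arc (u, v)" "z (arc_bit (u, v))"
      using that(2) \<open>inv u\<close> 2 by (auto simp: up_open_iff inv_def)
    then have "strip v = strip u" "strip_start (strip u) \<le> fst u + snd u"
      by (auto simp: strip_arc_def)
    then have t: "strip_time v = Suc (strip_time u)"
      using 2 by (simp add: strip_time_def Suc_diff_le)
    \<comment> \<open>The case \<open>j = 0\<close> is the moment of leaving the bottom row,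
      possible at any time of the walk.\<close>
    have "j \<le> ups (block L (strip u) z) (strip_time u)"
      using \<open>inv u\<close> 2 by (cases j) (auto simp: inv_def)
    then have le: "snd v \<le> ups (block L (strip v) z) (strip_time v)"
      using s bit[of u v] 2 t by (auto simp: strip_arc_def)
    have "strip v < M" "strip_time v \<le> L" "strip_start (strip v) \<le> fst v + snd v"
      using s 2 t by (auto simp: strip_arc_def)
    then show ?thesis using le top[of "strip v" "strip_time v"] by (simp add: inv_def)
  qed
  have "inv v" if "((0, 0), v) \<in> (open_arcs z)\<^sup>*" for v
    using that
  proof induction
    case base
    show ?case using h0 by (simp add: inv_def)
  next
    case (step u v)
    then show ?case using inv_step by blast
  qed
  moreover have "\<not> inv (n, k)" using h_le by (simp add: inv_def)
  ultimately have "((0, 0), (n, k)) \<notin> (open_arcs z)\<^sup>*" by blast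
  then show ?thesis by (simp add: dconnectivity_2d_iff)
qed

text \<open>The path follows the bottom row to the start of strip \<open>s\<close>, then the walk
  through the vertices \<open>pos t\<close>, then row \<open>h\<close> to column \<open>n\<close>
  and this column to the sink. The band condition keeps the walk inside its strip.\<close>

lemma connected:
  assumes s: "s < M" and up: "height (block L s z) L = 1"
    and band: "\<And>t. t \<le> L \<Longrightarrow> \<bar>height (block L s z) t\<bar> \<le> int W"
  shows "dconnectivity_2d n k (grid_input z)"
proof -
  define x where "x = block L s z"
  define pos where "pos t = (strip_start s + t - ups x t, ups x t)" for t
  have top: "ups x L = h" using up length_eq by (simp add: height_eq_ups x_def)
  have "Suc s * (2 * W + 1) \<le> M * (2 * W + 1)" using s by (intro mult_right_mono) auto
  then have start: "strip_start s + L \<le> n" using fits by (simp add: strip_start_def)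
  have band': "int (ups x t) \<le> int W + int t - int (ups x t)" "int t - 2 * int (ups x t) \<le> int W" if "t \<le> L" for t
    using band[OF that] by (simp_all add: height_eq_ups x_def)
  have off: "ups x t \<le> strip_start s + t - ups x t" "strip (pos t) = s" if "t \<le> L" for t
  proof -
    show 1: "ups x t \<le> strip_start s + t - ups x t"
      using band'[OF that] ups_le[of x t] by (simp add: strip_start_def)
    have "fst (pos t) - snd (pos t) = s * (2 * W + 1) + (W + t - 2 * ups x t)"
      using band'[OF that] ups_le[of x t] by (simp add: pos_def strip_start_def)
    moreover have "W + t - 2 * ups x t < 2 * W + 1" using band'[OF that] by linarith
    ultimately show "strip (pos t) = s"
      by (simp only: strip_def) (subst div_mult_self3, simp_all)
  qed
  have time: "strip_time (pos t) = t" "strip_start s \<le> fst (pos t) + snd (pos t)" if "t \<le> L" for t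
    using off[OF that] ups_le[of x t] by (simp_all add: strip_time_def pos_def)
  have pos0: "((0, 0), pos 0) \<in> (open_arcs z)\<^sup>*"
    unfolding pos_def using start by (simp, intro right_reachable) (auto simp: right_open_iff)
  have step: "(pos t, pos (Suc t)) \<in> open_arcs z" if "t < L" for t
  proof -
    have bit: "z (arc_bit (pos t, v)) = x t" for v
      using that time[of t] off[of t] by (simp add: arc_bit_def x_def block_def)
    have live: "strip_arc (pos t, pos (Suc t))" if "ups x t < h"
      using s \<open>t < L\<close> that off[of t] off[of "Suc t"] time[of t]
      by (simp add: strip_arc_def) (simp add: pos_def)
    show ?thesis
    proof (cases "x t")
      case True
      have "ups x (Suc t) \<le> h" using ups_mono[of "Suc t" L x] top that by simp
      then have lt: "ups x t < h" using True by simp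
      have "pos (Suc t) = (fst (pos t), Suc (snd (pos t)))" using True by (simp add: pos_def)
      then show ?thesis
        using live[OF lt] bit True lt h_le start that up_open_iff[of "fst (pos t)" "snd (pos t)" z]
        by (auto simp: pos_def)
    next
      case False
      \<comment> \<open>After the last up step the walk moves in row \<open>h\<close>, which has no
        strip arcs but only free horizontal ones.\<close>
      have le: "ups x t \<le> h" using ups_mono[of t L x] top that by simp
      have "pos (Suc t) = (Suc (fst (pos t)), snd (pos t))"
        using False ups_le[of x t] by (simp add: pos_def)
      then show ?thesis
        using live bit False le h_le start that right_open_iff[of "fst (pos t)" "snd (pos t)" z]
        by (cases "ups x t = h") (auto simp: pos_def)
    qed
  qed
  have "((0, 0), pos t) \<in> (open_arcs z)\<^sup>*" if "t \<le> L" for t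
    using that
  proof (induction t)
    case (Suc t)
    then show ?case using rtrancl_into_rtrancl[OF _ step[of t]] by simp
  qed (use pos0 in simp)
  then have "((0, 0), pos L) \<in> (open_arcs z)\<^sup>*" by simp
  also have "(pos L, (n, h)) \<in> (open_arcs z)\<^sup>*"
    unfolding pos_def top using start h_le by (intro right_reachable) (auto simp: right_open_iff)
  also have "((n, h), (n, k)) \<in> (open_arcs z)\<^sup>*"
    using h_le by (intro up_reachable) (auto simp: up_open_iff)
  finally show ?thesis by (simp add: dconnectivity_2d_iff)
qed

end

lemma dconnectivity_2d_all: "dconnectivity_2d n k (\<lambda>e\<in>parcs (grid_digraph n k). True)"
proof -
  let ?E = "parcs (input_subgraph n k (\<lambda>e\<in>parcs (grid_digraph n k). True))"
  have "((0, 0), (n, 0)) \<in> ?E\<^sup>*"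
    by (intro right_reachable) (auto simp: input_subgraph_def grid_digraph_def)
  also have "((n, 0), (n, k)) \<in> ?E\<^sup>*"
    by (intro up_reachable) (auto simp: input_subgraph_def grid_digraph_def)
  finally show ?thesis by (simp add: dconnectivity_2d_iff)
qed

lemma not_dconnectivity_2d_none:
  assumes "0 < k"
  shows "\<not> dconnectivity_2d n k (\<lambda>e\<in>parcs (grid_digraph n k). False)"
proof -
  have "parcs (input_subgraph n k (\<lambda>e\<in>parcs (grid_digraph n k). False)) = {}"
    by (auto simp: input_subgraph_def)
  then show ?thesis using assms by (simp add: dconnectivity_2d_iff)
qed

section \<open>The lower bound\<close>

lemma finite_bit_strings: "finite {z :: nat \<Rightarrow> bool. (\<forall>p\<ge>N. \<not> z p) \<and> P z}"
proof (rule finite_subset)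
  show "{z :: nat \<Rightarrow> bool. (\<forall>p\<ge>N. \<not> z p) \<and> P z} \<subseteq> (\<lambda>S p. p \<in> S) ` Pow {..<N}"
  proof
    fix z :: "nat \<Rightarrow> bool" assume "z \<in> {z. (\<forall>p\<ge>N. \<not> z p) \<and> P z}"
    then have "Collect z \<in> Pow {..<N}" by (auto simp: not_le[symmetric])
    then show "z \<in> (\<lambda>S p. p \<in> S) ` Pow {..<N}" by (auto intro!: image_eqI[of _ _ "Collect z"])
  qed
qed simp

lemma card_flip_bit_image: "card ((\<lambda>i. flip_bit x i) ` S) = card S"
  by (rule card_image) (simp add: inj_on_def)

text \<open>The OR of \<open>M\<close> blocks is the threshold with \<open>a = 0\<close>, which
  gives degrees \<open>M * m ^ l\<close> and \<open>Suc m ^ l\<close>. The half-width of the strips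
  is the band of \<open>height_iter\<close>.\<close>

lemma grid_query_bound:
  assumes grid: "strip_grid n k M (iter_length m l) (1 + (2 * m + 1) * l) h" and "0 < m" "0 < M"
    and comp: "computable_with_queries (parcs (grid_digraph n k)) (dconnectivity_2d n k) T"
  shows "sqrt (real (M * m ^ l) * real (Suc m ^ l)) \<le> 36 * real T"
proof -
  interpret strip_grid n k M "iter_length m l" "1 + (2 * m + 1) * l" h by (rule grid)
  define L where "L = iter_length m l"
  define V where "V = threshold_valid M 0 L (iter_valid m l) (iter_value m l)"
  define f where "f = threshold_value M 0 L (iter_value m l)"
  \<comment> \<open>Fixing all bits from \<open>M * L\<close> on to 0 makes \<open>X\<close> and
    \<open>Y\<close> finite.\<close>
  define X where "X = {z. (\<forall>p\<ge>M * L. \<not> z p) \<and> V z \<and> \<not> f z}"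
  define Y where "Y = {z. (\<forall>p\<ge>M * L. \<not> z p) \<and> V z \<and> f z}"
  define R where "R = {(x, y). x \<in> X \<and> y \<in> Y \<and> (\<exists>i<M * L. y = flip_bit x i)}"
  have fin: "finite X" "finite Y" unfolding X_def Y_def by (rule finite_bit_strings)+
  have sub: "R \<subseteq> X \<times> Y" by (auto simp: R_def)
  have supp: "\<forall>p\<ge>M * L. \<not> flip_bit x i p" if "\<forall>p\<ge>M * L. \<not> x p" "i < M * L" for x i
    using that by (auto simp: flip_bit_def)
  have sens: "sensitive (M * L) V f (M * m ^ l) (Suc m ^ l)"
    using sensitive_threshold[OF iter_sensitive[of m l], of M 0] by (simp add: V_def f_def L_def)
  have degX: "M * m ^ l \<le> card {y. (x, y) \<in> R}" if x: "x \<in> X" for x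
  proof -
    have "M * m ^ l \<le> card {i \<in> {..<M * L}. V (flip_bit x i) \<and> f (flip_bit x i)}"
      using sens x by (simp add: sensitive_def X_def)
    also have "\<dots> = card ((\<lambda>i. flip_bit x i) ` {i \<in> {..<M * L}. V (flip_bit x i) \<and> f (flip_bit x i)})"
      by (simp only: card_flip_bit_image)
    also have "\<dots> \<le> card {y. (x, y) \<in> R}"
    proof (rule card_mono)
      show "finite {y. (x, y) \<in> R}" by (rule finite_subset[OF _ fin(2)]) (use sub in auto)
      have "(x, flip_bit x i) \<in> R" if "i < M * L" "V (flip_bit x i)" "f (flip_bit x i)" for i
        using x that supp[of x i] unfolding R_def X_def Y_def by blast
      then show "(\<lambda>i. flip_bit x i) ` {i \<in> {..<M * L}. V (flip_bit x i) \<and> f (flip_bit x i)} \<subseteq> {y. (x, y) \<in> R}"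
        by auto
    qed
    finally show ?thesis .
  qed
  have degY: "Suc m ^ l \<le> card {x. (x, y) \<in> R}" if y: "y \<in> Y" for y
  proof -
    have "Suc m ^ l \<le> card {i \<in> {..<M * L}. V (flip_bit y i) \<and> \<not> f (flip_bit y i)}"
      using sens y by (simp add: sensitive_def Y_def)
    also have "\<dots> = card ((\<lambda>i. flip_bit y i) ` {i \<in> {..<M * L}. V (flip_bit y i) \<and> \<not> f (flip_bit y i)})"
      by (simp only: card_flip_bit_image)
    also have "\<dots> \<le> card {x. (x, y) \<in> R}"
    proof (rule card_mono)
      show "finite {x. (x, y) \<in> R}" by (rule finite_subset[OF _ fin(1)]) (use sub in auto)
      have "(flip_bit y i, y) \<in> R" if "i < M * L" "V (flip_bit y i)" "\<not> f (flip_bit y i)" for i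
      proof -
        have "y = flip_bit (flip_bit y i) i" by simp
        then show ?thesis using y that supp[of y i] unfolding R_def X_def Y_def by blast
      qed
      then show "(\<lambda>i. flip_bit y i) ` {i \<in> {..<M * L}. V (flip_bit y i) \<and> \<not> f (flip_bit y i)} \<subseteq> {x. (x, y) \<in> R}"
        by auto
    qed
    finally show ?thesis .
  qed
  have "R \<noteq> {}"
  proof -
    obtain x where "x \<in> X"
      using threshold_realizable[of 0 M L "iter_valid m l" "iter_value m l" False] assms(2,3)
        iter_length_pos[of m l] iter_realizable[of m l]
      by (auto simp: X_def V_def f_def L_def)
    moreover have "0 < M * m ^ l" using assms(2,3) by simp
    ultimately have "card {y. (x, y) \<in> R} \<noteq> 0" using degX[of x] by linarith
    then show ?thesis by auto
  qed
  have unique: "i = arc_bit e" if "grid_input x e \<noteq> grid_input (flip_bit x i) e" for x i e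
    using grid_input_neq[OF that] by (auto simp: flip_bit_def split: if_splits)
  have blocks: "height (block L s z) L = (if iter_value m l (block L s z) then 1 else - 1)"
    if "V z" "s < M" for z s
    using that height_iter(1)[of m l "block L s z"] by (simp add: V_def threshold_valid_def L_def)
  show ?thesis
  proof (rule adversary_bound[OF finite_grid_arcs comp fin sub \<open>R \<noteq> {}\<close>, where \<phi> = grid_input])
    show "grid_input z \<in> parcs (grid_digraph n k) \<rightarrow>\<^sub>E UNIV" for z
      unfolding grid_input_def by auto
  next
    fix z assume z: "z \<in> X"
    then have "{b \<in> {..<M}. iter_value m l (block L b z)} = {}"
      by (auto simp: X_def V_def f_def threshold_valid_def threshold_value_def)
    then show "\<not> dconnectivity_2d n k (grid_input z)"
      using z blocks[of z] by (intro not_connected) (auto simp: X_def L_def)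
  next
    fix z assume z: "z \<in> Y"
    then have "card {b \<in> {..<M}. iter_value m l (block L b z)} = 1"
      by (simp add: Y_def f_def threshold_value_def)
    then obtain s where s: "s < M" "iter_value m l (block L s z)"
      by (auto simp: card_1_singleton_iff)
    have valid: "iter_valid m l (block L s z)" using z s by (simp add: Y_def V_def threshold_valid_def)
    have "height (block (iter_length m l) s z) (iter_length m l) = 1"
      using height_iter(1)[OF valid] s(2) by (simp only: L_def if_True)
    moreover have "int (1 + (2 * m + 1) * l) = 1 + (2 * int m + 1) * int l"
      by (simp add: algebra_simps)
    then have "\<bar>height (block (iter_length m l) s z) t\<bar> \<le> int (1 + (2 * m + 1) * l)"
      if "t \<le> iter_length m l" for t
      using height_iter(2)[OF valid[unfolded L_def] that] by (simp only: L_def)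
    ultimately show "dconnectivity_2d n k (grid_input z)"
      by (rule connected[OF s(1)])
  next
    fix x e
    have "{y. (x, y) \<in> R \<and> grid_input x e \<noteq> grid_input y e} \<subseteq> {flip_bit x (arc_bit e)}"
    proof
      fix y assume y: "y \<in> {y. (x, y) \<in> R \<and> grid_input x e \<noteq> grid_input y e}"
      then obtain i where "y = flip_bit x i" unfolding R_def by blast
      then show "y \<in> {flip_bit x (arc_bit e)}" using y unique[of x e i] by simp
    qed
    from card_mono[OF _ this] show "card {y. (x, y) \<in> R \<and> grid_input x e \<noteq> grid_input y e} \<le> 1"
      by simp
  next
    fix y e
    have "{x. (x, y) \<in> R \<and> grid_input x e \<noteq> grid_input y e} \<subseteq> {flip_bit y (arc_bit e)}"
    proof
      fix x assume x: "x \<in> {x. (x, y) \<in> R \<and> grid_input x e \<noteq> grid_input y e}"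
      then obtain i where i: "y = flip_bit x i" unfolding R_def by blast
      then have "i = arc_bit e" using x unique[of x e i] by simp
      then show "x \<in> {flip_bit y (arc_bit e)}" using i by simp
    qed
    from card_mono[OF _ this] show "card {x. (x, y) \<in> R \<and> grid_input x e \<noteq> grid_input y e} \<le> 1"
      by simp
  qed (fact degX degY)+
qed

text \<open>The empty and the full subgraph have different values, so the adversary bound for this
  single pair excludes \<open>T = 0\<close>. This settles the small grids later.\<close>

lemma queries_pos:
  assumes "0 < k" "computable_with_queries (parcs (grid_digraph n k)) (dconnectivity_2d n k) T"
  shows "1 \<le> T"
proof -
  let ?I = "parcs (grid_digraph n k)"
  have sets: "{y. y} = {True}" "{x. \<not> x} = {False}" by auto
  have "sqrt (real 1 * real 1) \<le> 36 * real T"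
    by (rule adversary_bound[OF finite_grid_arcs assms(2), of "{False}" "{True}" "{(False, True)}"
          "\<lambda>b. \<lambda>e\<in>?I. b"])
       (use dconnectivity_2d_all not_dconnectivity_2d_none[OF assms(1)] in
         \<open>auto simp: card_le_Suc0_iff_eq sets\<close>)
  then show ?thesis by (cases T) auto
qed

lemma quantum_query_complexity_geI:
  assumes "\<And>T. computable_with_queries I g T \<Longrightarrow> r \<le> real T"
  shows "ereal r \<le> ereal_of_enat (quantum_query_complexity I g)"
proof (cases "{T. computable_with_queries I g T} = {}")
  \<comment> \<open>If no number of queries suffices, the infimum over the empty set is
    infinite.\<close>
  case True
  then have "quantum_query_complexity I g = \<infinity>"
    unfolding quantum_query_complexity_def by (simp only:) (simp add: top_enat_def)
  then show ?thesis by simp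
next
  case False
  then have "quantum_query_complexity I g \<in> enat ` {T. computable_with_queries I g T}"
    unfolding quantum_query_complexity_def Inf_enat_def by (auto intro: LeastI)
  then show ?thesis using assms by auto
qed

section \<open>Choice of depth and branching\<close>

lemma exists_level:
  fixes a b k :: nat
  assumes "2 \<le> b" "0 < a"
  obtains l where "k < a * b ^ Suc l" "l = 0 \<or> a * b ^ l \<le> k"
proof -
  define l where "l = (LEAST l. k < a * b ^ Suc l)"
  have "k < 2 ^ k" by (rule less_exp)
  also have "2 ^ k \<le> b ^ k" using assms(1) by (intro power_mono) auto
  also have "b ^ k \<le> a * b ^ Suc k" using assms by simp
  finally have "k < a * b ^ Suc l" unfolding l_def by (rule LeastI)
  moreover have "l = 0 \<or> a * b ^ l \<le> k"
  proof (cases l)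
    case (Suc l')
    then have "\<not> k < a * b ^ Suc l'" using not_less_Least[of l' "\<lambda>l. k < a * b ^ Suc l"] by (simp add: l_def)
    then show ?thesis using Suc by simp
  qed simp
  ultimately show ?thesis using that by blast
qed

text \<open>The choice of \<open>m\<close> makes \<open>m powr \<delta>\<close> at least 6: a factor
  3 pays for replacing \<open>2 * m + 1\<close> by \<open>3 * m\<close>, and a factor 2 is gained
  per level.\<close>

lemma exists_branching:
  fixes \<delta> :: real
  assumes "0 < \<delta>" "\<delta> < 1"
  obtains m :: nat where "0 < m" "real (2 * m + 1) powr (1 - \<delta>) \<le> real m / 2"
proof
  define m where "m = nat \<lceil>6 powr (1 / \<delta>)\<rceil>"
  have ge: "6 powr (1 / \<delta>) \<le> real m" unfolding m_def by linarith
  have "1 powr (1 / \<delta>) \<le> (6::real) powr (1 / \<delta>)" using assms by (intro powr_mono2) auto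
  with ge have m1: "1 \<le> real m" by simp
  then show "0 < m" by simp
  have "6 = (6 powr (1 / \<delta>)) powr \<delta>" using assms by (simp add: powr_powr)
  also have "\<dots> \<le> real m powr \<delta>" using ge assms by (intro powr_mono2) auto
  finally have six: "6 \<le> real m powr \<delta>" .
  have "real (2 * m + 1) powr (1 - \<delta>) \<le> (3 * real m) powr (1 - \<delta>)"
    using assms m1 by (intro powr_mono2) auto
  also have "\<dots> = 3 powr (1 - \<delta>) * real m powr (1 - \<delta>)" using m1 by (simp add: powr_mult)
  also have "\<dots> \<le> 3 * real m powr (1 - \<delta>)"
    using powr_mono[of "1 - \<delta>" 1 "3::real"] assms by (intro mult_right_mono) auto
  also have "\<dots> = 3 * (real m / real m powr \<delta>)" using m1 by (simp add: powr_diff)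
  also have "\<dots> \<le> 3 * (real m / 6)" using six m1 by (intro mult_left_mono divide_left_mono) auto
  finally show "real (2 * m + 1) powr (1 - \<delta>) \<le> real m / 2" by simp
qed

text \<open>The strip width, linear in \<open>l\<close>, is bounded crudely by
  \<open>A * 2 ^ l\<close>; this loss turns \<open>m ^ l\<close> into \<open>(m / 2) ^ l\<close>.
  The depth is taken so large that \<open>k\<close> is at most a constant times
  \<open>b ^ l\<close>.\<close>

lemma grid_query_bound_large:
  fixes m n k T :: nat
  defines "b \<equiv> 2 * m + 1"
  defines "A \<equiv> 3 + 2 * b"
  assumes "0 < m" "0 < k" "k \<le> n" "2 * A \<le> n"
    and comp: "computable_with_queries (parcs (grid_digraph n k)) (dconnectivity_2d n k) T"
  obtains l where "k \<le> 2 * A * b ^ Suc l" "sqrt (real n) * (real m / 2) ^ l \<le> 72 * real A * real T"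
proof -
  obtain l where l: "k < 2 * A * b ^ Suc l" "l = 0 \<or> 2 * A * b ^ l \<le> k"
    using exists_level[of b "2 * A" k] assms(3) by (auto simp: b_def A_def)
  \<comment> \<open>\<open>D\<close> is the width of a strip. Half of the columns go to the strips,
    the other half leave room for the length \<open>L\<close> of the walks.\<close>
  define L D where "L = iter_length m l" and "D = 2 * (1 + b * l) + 1"
  define M where "M = n div (2 * D)"
  have "l \<le> 2 ^ l" using less_exp[of l] by simp
  have "D = 3 + 2 * (b * l)" by (simp add: D_def)
  also have "\<dots> \<le> 3 * 2 ^ l + 2 * (b * 2 ^ l)"
    using \<open>l \<le> 2 ^ l\<close> by (intro add_mono mult_le_mono2) auto
  also have "\<dots> = A * 2 ^ l" by (simp add: A_def algebra_simps)
  finally have DA: "D \<le> A * 2 ^ l" .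
  have two: "2 ^ l \<le> b ^ l" using assms(3) by (intro power_mono) (auto simp: b_def)
  \<comment> \<open>For \<open>l = 0\<close> this is the assumption on \<open>n\<close>; otherwise
    it follows from \<open>k \<le> n\<close>.\<close>
  have n: "2 * A * b ^ l \<le> n" using l(2) assms(5,6) by auto
  have "2 * D \<le> 2 * A * b ^ l"
    using DA mult_le_mono2[OF two, of A] by linarith
  then have Dn: "2 * D \<le> n" using n by simp
  have D0: "0 < D" by (simp add: D_def)
  have M0: "0 < M" using Dn D0 by (simp add: M_def div_greater_zero_iff)
  have Lb: "L \<le> b ^ l" using iter_length_le[of m l] by (simp add: L_def b_def)
  have "2 * b ^ l \<le> 2 * A * b ^ l" by (simp add: A_def)
  then have Ln: "2 * L \<le> n" using Lb n by linarith
  have Lk: "L \<le> k"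
    using l(2)
  proof
    assume "l = 0" then show ?thesis using assms(4) by (simp add: L_def)
  next
    assume "2 * A * b ^ l \<le> k"
    moreover have "b ^ l \<le> 2 * A * b ^ l" by (simp add: A_def)
    ultimately show ?thesis using Lb by linarith
  qed
  have "M * (2 * D) \<le> n" unfolding M_def by (rule div_times_less_eq_dividend)
  then have fits: "M * D + L \<le> n" using Ln by linarith
  obtain h where h: "L + 1 = 2 * h"
    using odd_iter_length[of m l] unfolding L_def by (metis Suc_eq_plus1 even_Suc dvdE)
  have "strip_grid n k M (iter_length m l) (1 + (2 * m + 1) * l) h"
    using h fits Lk iter_length_pos[of m l] by unfold_locales (auto simp: L_def D_def b_def)
  from grid_query_bound[OF this assms(3) M0 comp]
  have bound: "sqrt (real (M * m ^ l) * real (Suc m ^ l)) \<le> 36 * real T" .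
  have "n < 2 * D * (M + 1)" unfolding M_def using D0 dividend_less_div_times[of "2 * D" n] by (simp add: algebra_simps)
  also have "\<dots> \<le> 4 * D * M" using M0 by (cases M) auto
  also have "\<dots> \<le> 4 * (A * 2 ^ l) * M" using DA by (intro mult_le_mono1 mult_le_mono2)
  \<comment> \<open>Enlarged to a perfect square times \<open>M\<close>, so that the square root can
    be taken exactly.\<close>
  also have "\<dots> \<le> 4 * (A * A * 4 ^ l) * M"
  proof -
    have "(2::nat) ^ l \<le> 4 ^ l" by (intro power_mono) auto
    moreover have "A \<le> A * A" by (simp add: A_def)
    ultimately have "A * 2 ^ l \<le> A * A * 4 ^ l" by (intro mult_le_mono)
    then show ?thesis by (intro mult_le_mono1 mult_le_mono2)
  qed
  finally have "real n \<le> real (4 * (A * A * 4 ^ l) * M)" by (simp only: of_nat_le_iff less_imp_le)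
  then have "sqrt (real n) \<le> sqrt ((2 * real A * 2 ^ l)\<^sup>2 * real M)"
    by (simp add: power2_eq_square power_mult_distrib[symmetric] mult_ac flip: power_mult_distrib)
  also have "\<dots> = 2 * real A * 2 ^ l * sqrt (real M)" by (simp add: real_sqrt_mult)
  finally have "sqrt (real n) * (real m / 2) ^ l \<le> 2 * real A * 2 ^ l * sqrt (real M) * (real m / 2) ^ l"
    by (intro mult_right_mono) auto
  also have "\<dots> = 2 * real A * (sqrt (real M) * real m ^ l)" by (simp add: power_divide)
  also have "sqrt (real M) * real m ^ l = sqrt (real (M * m ^ l) * real (m ^ l))"
    by (simp add: real_sqrt_mult)
  also have "\<dots> \<le> sqrt (real (M * m ^ l) * real (Suc m ^ l))"
    by (intro real_sqrt_le_mono mult_left_mono of_nat_mono power_mono) auto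
  also note bound
  finally have "sqrt (real n) * (real m / 2) ^ l \<le> 72 * real A * real T" by (simp add: mult_left_mono)
  then show ?thesis by (rule that[OF less_imp_le[OF l(1)]])
qed

theorem theorem7:
  fixes \<epsilon> :: real
  assumes "\<epsilon> > 0"
  shows "\<exists>c::real. c > 0 \<and> (\<forall>n k :: nat. n \<ge> k \<longrightarrow>
           ereal_of_enat (quantum_query_complexity (parcs (grid_digraph n k)) (dconnectivity_2d n k))
             \<ge> ereal (c * (sqrt (real n) * real k) powr (1 - \<epsilon>)))"
proof -
  \<comment> \<open>Capping at 1/2 keeps the exponent positive when
    \<open>\<epsilon> \<ge> 1\<close>; a smaller loss only strengthens the bound because the base is
    at least 1.\<close>
  define \<delta> where "\<delta> = min \<epsilon> (1 / 2)"
  have \<delta>: "0 < \<delta>" "\<delta> < 1" "\<delta> \<le> \<epsilon>" using assms by (auto simp: \<delta>_def)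
  obtain m :: nat where m: "0 < m" "real (2 * m + 1) powr (1 - \<delta>) \<le> real m / 2"
    using exists_branching[OF \<delta>(1,2)] .
  define b A where "b = 2 * m + 1" and "A = 3 + 2 * b"
  \<comment> \<open>The product of \<open>2 * A * b\<close>, from the bound on \<open>k\<close>, and
    \<open>72 * A\<close>, from the query bound; it also exceeds \<open>(2 * A)\<^sup>2\<close>,
    which covers \<open>n < 2 * A\<close>.\<close>
  define C where "C = 144 * real A * real A * real b"
  have pos: "1 \<le> real A" "1 \<le> real b" by (simp_all add: A_def b_def)
  then have C: "0 < C" by (simp add: C_def)
  have main: "1 / C * (sqrt (real n) * real k) powr (1 - \<epsilon>) \<le> real T"
    if nk: "k \<le> n" and comp: "computable_with_queries (parcs (grid_digraph n k)) (dconnectivity_2d n k) T"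
    for n k T
  proof (cases "k = 0")
    \<comment> \<open>Here the base is 0, and \<open>0 powr r = 0\<close> for every
      exponent.\<close>
    case True then show ?thesis by simp
  next
    case False
    then have k: "1 \<le> real k" "1 \<le> real n" "0 < k" using nk by auto
    have sn: "1 \<le> sqrt (real n)" "sqrt (real n) \<le> real n"
      using k by (simp_all add: real_le_lsqrt power2_eq_square)
    have "1 * 1 \<le> sqrt (real n) * real k" using sn k by (intro mult_mono) auto
    then have mono: "(sqrt (real n) * real k) powr (1 - \<epsilon>) \<le> (sqrt (real n) * real k) powr (1 - \<delta>)"
      using \<delta> by (intro powr_mono) auto
    have T: "1 \<le> real T" using queries_pos[OF k(3) comp] by simp
    have "(sqrt (real n) * real k) powr (1 - \<delta>) \<le> C * real T"
    proof (cases "n < 2 * A")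
      case True
      have "(sqrt (real n) * real k) powr (1 - \<delta>) \<le> (sqrt (real n) * real k) powr 1"
        using \<delta> \<open>1 * 1 \<le> _\<close> by (intro powr_mono) auto
      also have "\<dots> = sqrt (real n) * real k" using k by simp
      also have "\<dots> \<le> real n * real n" using sn nk by (intro mult_mono) auto
      also have "\<dots> \<le> real (2 * A) * real (2 * A)" using True by (intro mult_mono) auto
      also have "\<dots> = 4 * (real A * real A) * 1" by simp
      also have "\<dots> \<le> 144 * (real A * real A) * real b"
        using pos by (intro mult_mono) auto
      also have "\<dots> = C * 1" by (simp add: C_def)
      also have "\<dots> \<le> C * real T" using T C by (intro mult_left_mono) auto
      finally show ?thesis .
    next
      case False
      then have "2 * A \<le> n" by simp
      then obtain l where l: "k \<le> 2 * A * b ^ Suc l"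
        "sqrt (real n) * (real m / 2) ^ l \<le> 72 * real A * real T"
        using grid_query_bound_large[OF m(1) k(3) nk _ comp] unfolding A_def b_def by blast
      have "real k \<le> real (2 * A * b ^ Suc l)" using l(1) by (simp only: of_nat_le_iff)
      then have kl: "real k \<le> (2 * real A * real b) * real b ^ l" by simp
      have "(sqrt (real n) * real k) powr (1 - \<delta>) = sqrt (real n) powr (1 - \<delta>) * real k powr (1 - \<delta>)"
        by (simp add: powr_mult)
      also have "\<dots> \<le> sqrt (real n) * ((2 * real A * real b) * real b ^ l) powr (1 - \<delta>)"
        using powr_mono[of "1 - \<delta>" 1 "sqrt (real n)"] sn(1) \<delta> kl
        by (intro mult_mono powr_mono2) auto
      \<comment> \<open>Moving the exponent inside the power leaves one factor
        \<open>b powr (1 - \<delta>)\<close> per level, which the choice of \<open>m\<close> bounds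
        by \<open>m / 2\<close>.\<close>
      also have "((2 * real A * real b) * real b ^ l) powr (1 - \<delta>)
          = (2 * real A * real b) powr (1 - \<delta>) * (real b powr (1 - \<delta>)) ^ l"
        using pos by (simp add: powr_mult powr_power powr_powr mult.commute flip: powr_realpow)
      also have "\<dots> \<le> (2 * real A * real b) * (real m / 2) ^ l"
      proof (intro mult_mono power_mono)
        have "1 * 1 \<le> (2 * real A) * real b" using pos by (intro mult_mono) auto
        then show "(2 * real A * real b) powr (1 - \<delta>) \<le> 2 * real A * real b"
          using powr_mono[of "1 - \<delta>" 1 "2 * real A * real b"] \<delta> by simp
        show "real b powr (1 - \<delta>) \<le> real m / 2" using m(2) by (simp add: b_def)
      qed auto
      also have "sqrt (real n) * ((2 * real A * real b) * (real m / 2) ^ l)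
          = (2 * real A * real b) * (sqrt (real n) * (real m / 2) ^ l)" by simp
      also have "\<dots> \<le> (2 * real A * real b) * (72 * real A * real T)"
        using l(2) by (intro mult_left_mono) auto
      also have "\<dots> = C * real T" by (simp add: C_def)
      finally show ?thesis by (simp add: mult_left_mono)
    qed
    with mono have "(sqrt (real n) * real k) powr (1 - \<epsilon>) \<le> C * real T" by simp
    then show ?thesis using C by (simp add: field_simps)
  qed
  show ?thesis
    using C main by (intro exI[of _ "1 / C"] conjI allI impI quantum_query_complexity_geI) auto
qed

end
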